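(* Let $\epsilon_0\in\{1,-1\}$. If $n+s$ is even with $0\le s\le n-4$ and $n+s\ge6$, there exists a ternary pure quantum code with parameters $[[\frac{3^{n-1}+2\epsilon_0\cdot3^{\frac{n+s}{2}-1}-1}{2},\,\frac{3^{n-1}+2\epsilon_0\cdot3^{\frac{n+s}{2}-1}-1}{2}-2n+2,\,3]]_3$, which is at least almost optimal according to the quantum Hamming bound. If $n+s$ is odd with $0\le s\le n-3$ and $n+s\ge5$, there exists a ternary pure quantum code with parameters $[[\frac{3^{n-1}-1}{2},\,\frac{3^{n-1}-1}{2}-2n+2,\,3]]_3$, which is at least almost optimal according to the quantum Hamming bound.
   Context: $n,s$ are non-negative integers. A $p$-ary $[[N,K,d]]_p$ quantum code is a $p^K$-dimensional subspace $Q$ of $\mathbb{C}^{p^N}$ with minimum distance $d$; it is pure if $\langle v_1|E|v_2\rangle=0$ for all $v_1,v_2\in Q$ and every error operator $E$ of quantum weight between $1$ and $d-1$. The quantum Hamming bound for a pure $[[N,K,d]]_p$ code is $p^{N-K}\ge\sum_{j=0}^{\lfloor(d-1)/2\rfloor}\binom{N}{j}(p^2-1)^j$. An $[[N,K,d]]_p$ code is optimal if no $[[N,K,d+1]]_p$ code exists, almost optimal if an optimal $[[N,K,d+1]]_p$ code exists; "at least almost optimal according to the quantum Hamming bound" means the quantum Hamming bound certifies it is optimal or almost optimal for its length and dimension. *)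

theory Defs
  imports Complex_Main
begin

text \<open>Computational basis of (C^p)^{\<otimes>N}: words of length N over {0..p-1}.\<close>
definition words :: "nat \<Rightarrow> nat \<Rightarrow> nat list set" where
  "words p N = {xs. length xs = N \<and> (\<forall>x\<in>set xs. x < p)}"

type_synonym qstate = "nat list \<Rightarrow> complex"

text \<open>A vector of C^{p^N}, given by its coordinates in the computational basis.\<close>
definition is_state :: "nat \<Rightarrow> nat \<Rightarrow> qstate \<Rightarrow> bool" where
  "is_state p N v \<longleftrightarrow> (\<forall>x. x \<notin> words p N \<longrightarrow> v x = 0)"

definition braket :: "nat \<Rightarrow> nat \<Rightarrow> qstate \<Rightarrow> qstate \<Rightarrow> complex" where
  "braket p N v w = (\<Sum>x\<in>words p N. cnj (v x) * w x)"

definition omega :: "nat \<Rightarrow> complex" where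
  "omega p = cis (2 * pi / real p)"

text \<open>Generalized Pauli error Z(b)X(a): |x> \<mapsto> omega^(b.(x+a)) |x+a>.\<close>
definition pauli :: "nat \<Rightarrow> nat list \<Rightarrow> nat list \<Rightarrow> qstate \<Rightarrow> qstate" where
  "pauli p a b v = (\<lambda>y. if y \<in> words p (length a)
      then omega p ^ (\<Sum>i<length a. b ! i * y ! i) *
           v (map2 (\<lambda>yi ai. (yi + p - ai) mod p) y a)
      else 0)"

definition qweight :: "nat list \<Rightarrow> nat list \<Rightarrow> nat" where
  "qweight a b = card {i. i < length a \<and> (a ! i \<noteq> 0 \<or> b ! i \<noteq> 0)}"

definition lin_comb :: "nat \<Rightarrow> (nat \<Rightarrow> qstate) \<Rightarrow> (nat \<Rightarrow> complex) \<Rightarrow> qstate" where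
  "lin_comb m vs c = (\<lambda>x. \<Sum>i<m. c i * vs i x)"

definition lin_indep :: "nat \<Rightarrow> (nat \<Rightarrow> qstate) \<Rightarrow> bool" where
  "lin_indep m vs \<longleftrightarrow> (\<forall>c. lin_comb m vs c = (\<lambda>_. 0) \<longrightarrow> (\<forall>i<m. c i = 0))"

definition subspace_dim :: "nat \<Rightarrow> nat \<Rightarrow> nat \<Rightarrow> qstate set \<Rightarrow> bool" where
  "subspace_dim p N m Q \<longleftrightarrow>
     (\<exists>vs. (\<forall>i<m. is_state p N (vs i)) \<and> lin_indep m vs \<and> Q = range (lin_comb m vs))"

definition detects :: "nat \<Rightarrow> nat \<Rightarrow> qstate set \<Rightarrow> nat list \<Rightarrow> nat list \<Rightarrow> bool" where
  "detects p N Q a b \<longleftrightarrow> (\<exists>c. \<forall>v1\<in>Q. \<forall>v2\<in>Q.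
      braket p N v1 (pauli p a b v2) = c * braket p N v1 v2)"

definition quantum_code :: "nat \<Rightarrow> nat \<Rightarrow> nat \<Rightarrow> nat \<Rightarrow> qstate set \<Rightarrow> bool" where
  "quantum_code p N K d Q \<longleftrightarrow> subspace_dim p N (p ^ K) Q \<and>
     (\<forall>a\<in>words p N. \<forall>b\<in>words p N. qweight a b < d \<longrightarrow> detects p N Q a b) \<and>
     (\<exists>a\<in>words p N. \<exists>b\<in>words p N. qweight a b = d \<and> \<not> detects p N Q a b)"

definition pure_code :: "nat \<Rightarrow> nat \<Rightarrow> nat \<Rightarrow> qstate set \<Rightarrow> bool" where
  "pure_code p N d Q \<longleftrightarrow>
     (\<forall>a\<in>words p N. \<forall>b\<in>words p N. 1 \<le> qweight a b \<and> qweight a b \<le> d - 1 \<longrightarrow>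
        (\<forall>v1\<in>Q. \<forall>v2\<in>Q. braket p N v1 (pauli p a b v2) = 0))"

definition quantum_hamming_bound :: "nat \<Rightarrow> nat \<Rightarrow> nat \<Rightarrow> nat \<Rightarrow> bool" where
  "quantum_hamming_bound p N K d \<longleftrightarrow>
     p ^ (N - K) \<ge> (\<Sum>j\<le>(d - 1) div 2. (N choose j) * (p\<^sup>2 - 1) ^ j)"

text \<open>The Hamming bound certifies optimal-or-almost-optimal: it rules out
  (pure) [[N,K,d+2]]_p codes.\<close>
definition QHB_at_least_almost_optimal :: "nat \<Rightarrow> nat \<Rightarrow> nat \<Rightarrow> nat \<Rightarrow> bool" where
  "QHB_at_least_almost_optimal p N K d \<longleftrightarrow> \<not> quantum_hamming_bound p N K (d + 2)"

end

theory Submission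
  imports Defs
begin

text \<open>
  Put \<open>m = n - 1\<close>. A set \<open>X\<close> of \<open>N\<close> points of the projective space of \<open>F\<^sub>9\<^sup>m\<close> with
  \<open>\<Sum>\<^sub>x x\<^sub>r x\<^sub>s = \<Sum>\<^sub>x x\<^sub>r cnj x\<^sub>s = 0\<close> for all coordinates \<open>r\<close>, \<open>s\<close> yields a stabilizer group of order at most
  \<open>3\<^sup>2\<^sup>m\<close>: the functional \<open>\<lambda>\<close> gives the Pauli operator whose shift and phase parts at \<open>x\<close> are the real and
  imaginary parts of \<open>\<lambda>(x)\<close>. All its elements fix a common subspace of dimension at least \<open>3\<close> to the power
  \<open>N - 2m\<close>, and an error of weight one or two commuting with all of them would be an \<open>F\<^sub>9\<close>-linear relation
  between two points of \<open>X\<close>. Three collinear real points give an undetected phase error of weight three.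

  The points over \<open>F\<^sub>3\<close> form such a set with \<open>(3\<^sup>m - 1)/2\<close> elements. A \<open>t\<close>-dimensional affine subspace with
  \<open>t \<ge> 2\<close> has \<open>3\<^sup>t\<close> points and vanishing moments of degree at most two as well, so it may be removed, or a
  translate of it by a purely imaginary vector may be added.
\<close>

section \<open>Words modulo \<open>p\<close>: scalar product and componentwise subtraction\<close>

definition dot :: "nat list \<Rightarrow> nat list \<Rightarrow> nat" where
  "dot x y = (\<Sum>i<length x. x ! i * y ! i)"

text \<open>The shift that \<open>pauli\<close> applies to its argument. Adding \<open>p\<close>
  before subtracting avoids truncation for entries of \<open>a\<close> below \<open>p\<close>.
  Together with the zero word, closure under this operation expresses being a subgroup.\<close>

definition wsub :: "nat \<Rightarrow> nat list \<Rightarrow> nat list \<Rightarrow> nat list" where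
  "wsub p y a = map2 (\<lambda>yi ai. (yi + p - ai) mod p) y a"

lemma dot_commute: "length x = length y \<Longrightarrow> dot x y = dot y x"
  by (simp add: dot_def mult.commute)

lemma dot_unit:
  assumes "length b = N" "i < N"
  shows "dot b ((replicate N 0)[i := 1]) = b ! i"
proof -
  have "dot b ((replicate N 0)[i := 1]) = (\<Sum>j<N. if j = i then b ! j else 0)"
    unfolding dot_def using assms by (intro sum.cong) (auto simp: nth_list_update)
  thus ?thesis using assms by simp
qed

lemma in_words_iff: "x \<in> words p N \<longleftrightarrow> length x = N \<and> (\<forall>i<N. x ! i < p)"
  by (auto simp: words_def all_set_conv_all_nth)

lemma words_length: "x \<in> words p N \<Longrightarrow> length x = N"
  by (simp add: words_def)

lemma words_eq: "words p N = {xs. set xs \<subseteq> {..<p} \<and> length xs = N}"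
  by (auto simp: words_def)

lemma finite_words [simp]: "finite (words p N)"
  unfolding words_eq by (rule finite_lists_length_eq) simp

lemma card_words: "card (words p N) = p ^ N"
  unfolding words_eq by (subst card_lists_length_eq) auto

lemma zero_in_words [simp]: "0 < p \<Longrightarrow> replicate N 0 \<in> words p N"
  by (simp add: in_words_iff)

lemma unit_in_words: "1 < p \<Longrightarrow> (replicate N 0)[i := 1] \<in> words p N"
  by (cases "i < N") (auto simp: in_words_iff nth_list_update)

lemma length_wsub [simp]: "length (wsub p y a) = min (length y) (length a)"
  by (simp add: wsub_def)

lemma nth_wsub: "i < length y \<Longrightarrow> i < length a \<Longrightarrow> wsub p y a ! i = (y ! i + p - a ! i) mod p"
  by (simp add: wsub_def)

lemma wsub_in_words:
  assumes "0 < p" "y \<in> words p N" "a \<in> words p N"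
  shows "wsub p y a \<in> words p N"
  using assms by (auto simp: in_words_iff nth_wsub)

lemma nth_wsub_int:
  assumes "y \<in> words p N" "a \<in> words p N" "i < N"
  shows "int (wsub p y a ! i) = (int (y ! i) - int (a ! i)) mod int p"
proof -
  have "a ! i \<le> y ! i + p" "i < length y" "i < length a"
    using assms by (auto simp: in_words_iff trans_le_add2 less_imp_le)
  hence "int (wsub p y a ! i) = (int (y ! i) - int (a ! i) + int p) mod int p"
    by (simp add: nth_wsub of_nat_mod of_nat_diff algebra_simps)
  thus ?thesis by simp
qed

text \<open>Entries are compared as integers, where \<open>nth_wsub_int\<close> reduces each group
  law for \<open>wsub\<close> to a simplification of residues.\<close>

lemma words_eqI:
  assumes "x \<in> words p N" "y \<in> words p N" "\<And>i. i < N \<Longrightarrow> int (x ! i) = int (y ! i)"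
  shows "x = y"
  using assms by (intro nth_equalityI) (auto simp: in_words_iff)

context
  fixes p N :: nat
  assumes p: "0 < p"
begin

lemma nth_words_mod: "x \<in> words p N \<Longrightarrow> i < N \<Longrightarrow> int (x ! i) mod int p = int (x ! i)"
  by (simp add: in_words_iff)

lemma wsub_self: "y \<in> words p N \<Longrightarrow> wsub p y y = replicate N 0"
  using p by (intro words_eqI[where p = p and N = N]) (auto simp: wsub_in_words nth_wsub_int)

lemma wsub_zero: "y \<in> words p N \<Longrightarrow> wsub p y (replicate N 0) = y"
  using p by (intro words_eqI[where p = p and N = N])
    (auto simp: wsub_in_words nth_wsub_int nth_words_mod)

lemma wsub_wsub_wsub:
  assumes "x \<in> words p N" "y \<in> words p N" "z \<in> words p N"
  shows "wsub p (wsub p x z) (wsub p y z) = wsub p x y"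
  using p assms by (intro words_eqI[where p = p and N = N])
    (auto simp: wsub_in_words nth_wsub_int[where N = N] mod_simps)

lemma wsub_commute:
  assumes "x \<in> words p N" "y \<in> words p N" "z \<in> words p N"
  shows "wsub p (wsub p x y) z = wsub p (wsub p x z) y"
  using p assms by (intro words_eqI[where p = p and N = N])
    (auto simp: wsub_in_words nth_wsub_int[where N = N] mod_simps algebra_simps)

lemma wsub_cancel:
  assumes "x \<in> words p N" "y \<in> words p N"
  shows "wsub p x (wsub p x y) = y"
  using p assms by (intro words_eqI[where p = p and N = N])
    (auto simp: wsub_in_words nth_wsub_int[where N = N] mod_simps nth_words_mod)

lemma wsub_swap:
  assumes "x \<in> words p N" "y \<in> words p N"
  shows "wsub p (replicate N 0) (wsub p x y) = wsub p y x"
  using p assms by (intro words_eqI[where p = p and N = N])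
    (auto simp: wsub_in_words nth_wsub_int[where N = N] mod_simps)

lemma inj_on_wsub:
  assumes "a \<in> words p N"
  shows "inj_on (\<lambda>y. wsub p y a) (words p N)"
proof (rule inj_onI)
  fix x y assume xy: "x \<in> words p N" "y \<in> words p N" "wsub p x a = wsub p y a"
  have "wsub p x y = wsub p (wsub p x a) (wsub p y a)"
    using xy(1,2) assms by (simp only: wsub_wsub_wsub)
  also have "\<dots> = wsub p x x"
    unfolding xy(3)[symmetric] using xy(1) assms by (simp only: wsub_wsub_wsub)
  finally have "wsub p x (wsub p x y) = wsub p x (wsub p x x)" by (rule arg_cong)
  thus "x = y" using xy(1,2) by (simp only: wsub_cancel)
qed

lemma inj_on_wsub_right:
  assumes "y \<in> words p N"
  shows "inj_on (wsub p y) (words p N)"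
  using assms by (intro inj_onI) (metis wsub_cancel)

lemma bij_betw_wsub:
  assumes "a \<in> words p N"
  shows "bij_betw (\<lambda>y. wsub p y a) (words p N) (words p N)"
  unfolding bij_betw_def using assms p
  by (intro conjI inj_on_wsub endo_inj_surj) (auto intro: wsub_in_words)

text \<open>Linearity modulo \<open>p\<close>, written with an added term instead of a difference to
  stay within the natural numbers.\<close>

lemma dot_wsub_right:
  assumes "d \<in> words p N" "y \<in> words p N" "a \<in> words p N"
  shows "(dot d (wsub p y a) + dot d a) mod p = dot d y mod p"
proof -
  have "(d ! i * (wsub p y a ! i) + d ! i * a ! i) mod p = (d ! i * y ! i) mod p" if "i < N" for i
  proof -
    have *: "length y = N" "length a = N" "a ! i < p" using that assms by (auto simp: in_words_iff)
    have "(d ! i * (wsub p y a ! i) + d ! i * a ! i) mod p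
        = (d ! i * (y ! i + p - a ! i) + d ! i * a ! i) mod p"
      using that * by (simp add: nth_wsub) (metis mod_add_left_eq mod_mult_right_eq)
    also have "d ! i * (y ! i + p - a ! i) + d ! i * a ! i = d ! i * y ! i + d ! i * p"
    proof -
      have "a ! i \<le> y ! i + p" using * by simp
      thus ?thesis by (simp flip: add_mult_distrib2)
    qed
    finally show ?thesis by simp
  qed
  hence "(\<Sum>i<N. (d ! i * (wsub p y a ! i) + d ! i * a ! i) mod p) mod p
      = (\<Sum>i<N. (d ! i * y ! i) mod p) mod p" by simp
  thus ?thesis using assms
    by (simp add: mod_sum_eq dot_def words_length flip: sum.distrib)
qed

lemma dot_wsub_left:
  assumes "d \<in> words p N" "b \<in> words p N" "y \<in> words p N"
  shows "(dot (wsub p d b) y + dot b y) mod p = dot d y mod p"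
  using dot_wsub_right[OF assms(3,1,2)] assms
  by (simp add: dot_commute[of _ y] words_length)

end

lemma dot_zero_left [simp]: "dot (replicate N 0) y = 0"
  by (simp add: dot_def)

lemma dot_zero_right [simp]: "length x \<le> N \<Longrightarrow> dot x (replicate N 0) = 0"
  by (simp add: dot_def)

section \<open>Roots of unity and orthogonality of characters\<close>

lemma omega_power: "omega p ^ k = cis (2 * pi * real k / real p)"
  by (simp add: omega_def DeMoivre mult_ac)

text \<open>The exponent can be reduced modulo \<open>p\<close>, and distinct exponents below
  \<open>p\<close> give distinct roots of unity.\<close>

lemma omega_power_eq_1_iff:
  assumes "0 < p"
  shows "omega p ^ k = 1 \<longleftrightarrow> p dvd k"
proof -
  have 1: "omega p ^ p = 1" using assms by (simp add: omega_power)
  have "omega p ^ k = omega p ^ (p * (k div p) + k mod p)" by simp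
  also have "\<dots> = omega p ^ (k mod p)"
    by (simp only: power_add power_mult 1) simp
  finally have 2: "omega p ^ k = omega p ^ (k mod p)" .
  have "k mod p = 0" if "omega p ^ (k mod p) = 1"
  proof (rule inj_onD[OF bij_betw_imp_inj_on[OF bij_betw_roots_unity[OF assms]]])
    show "cis (2 * pi * real (k mod p) / real p) = cis (2 * pi * real 0 / real p)"
      using that by (simp add: omega_power)
  qed (use assms in auto)
  moreover have "omega p ^ (k mod p) = 1" if "k mod p = 0" using that by simp
  ultimately show ?thesis unfolding 2 dvd_eq_mod_eq_0 by (rule iffI)
qed

lemma omega_nonzero [simp]: "omega p \<noteq> 0"
  by (simp add: omega_def)

lemma omega_power_eq_iff:
  assumes "0 < p"
  shows "omega p ^ j = omega p ^ k \<longleftrightarrow> j mod p = k mod p"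
proof -
  have *: "omega p ^ j = omega p ^ k \<longleftrightarrow> j mod p = k mod p" if "k \<le> j" for j k
  proof -
    have "omega p ^ j = omega p ^ k * omega p ^ (j - k)"
      using that by (simp flip: power_add)
    hence "omega p ^ j = omega p ^ k \<longleftrightarrow> omega p ^ (j - k) = 1" by simp
    thus ?thesis
      unfolding omega_power_eq_1_iff[OF assms] mod_eq_dvd_iff_nat[OF that] .
  qed
  show ?thesis using *[of j k] *[of k j] by (metis nat_le_linear)
qed

lemma omega_power_cong: "0 < p \<Longrightarrow> j mod p = k mod p \<Longrightarrow> omega p ^ j = omega p ^ k"
  by (simp add: omega_power_eq_iff)

lemma cnj_omega_power [simp]: "cnj (omega p ^ k) * omega p ^ k = 1"
  by (simp add: omega_power cis_cnj cis_mult)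

text \<open>Reindexing along \<open>h\<close> shows that the sum equals \<open>c\<close> times
  itself.\<close>

lemma sum_eq_0_if_twisted:
  fixes f :: "'a \<Rightarrow> complex"
  assumes "bij_betw h A A" "\<And>x. x \<in> A \<Longrightarrow> f (h x) = c * f x" "c \<noteq> 1"
  shows "sum f A = 0"
proof -
  have "sum f A = (\<Sum>x\<in>A. f (h x))" by (rule sum.reindex_bij_betw[OF assms(1), symmetric])
  also have "\<dots> = c * sum f A" using assms(2) by (simp add: sum_distrib_left)
  finally show ?thesis using assms(3) by simp
qed

lemma sum_characters_words:
  assumes p: "0 < p" and b: "b \<in> words p N"
  shows "(\<Sum>y\<in>words p N. omega p ^ dot b y) = (if b = replicate N 0 then of_nat (p ^ N) else 0)"
proof (cases "b = replicate N 0")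
  case False
  then obtain i where i: "i < N" "b ! i \<noteq> 0"
    using b by (metis in_words_iff length_replicate nth_equalityI nth_replicate)
  have p2: "p \<ge> 2" using i b by (cases "p = 1") (use p in \<open>auto simp: in_words_iff\<close>)
  \<comment> \<open>Translation along the unit vector at a nonzero entry of \<open>b\<close>
    multiplies the sum by a root of unity different from 1.\<close>
  define e where "e = (replicate N 0)[i := 1::nat]"
  have e: "e \<in> words p N" using p2 unfolding e_def by (intro unit_in_words) auto
  have be: "dot b e = b ! i"
    unfolding e_def by (rule dot_unit[OF words_length[OF b] i(1)])
  have "(\<Sum>y\<in>words p N. omega p ^ dot b y) = 0"
  proof (rule sum_eq_0_if_twisted[OF bij_betw_wsub[OF p e]])
    show "omega p ^ dot b (wsub p y e) = inverse (omega p ^ b ! i) * omega p ^ dot b y"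
      if "y \<in> words p N" for y
    proof -
      have "omega p ^ (dot b (wsub p y e) + b ! i) = omega p ^ dot b y"
        using dot_wsub_right[OF p b that e] be p by (intro omega_power_cong) auto
      thus ?thesis by (auto simp: power_add field_simps)
    qed
    show "inverse (omega p ^ b ! i) \<noteq> 1"
      using omega_power_eq_1_iff[OF p, of "b ! i"] i b by (auto simp: in_words_iff dest: nat_dvd_not_less)
  qed
  thus ?thesis using False by simp
qed (simp add: card_words)

section \<open>Pauli operators: unitarity and commutation up to a phase\<close>

lemma pauli_eq:
  assumes "a \<in> words p N" "b \<in> words p N"
  shows "pauli p a b v = (\<lambda>y. if y \<in> words p N then omega p ^ dot b y * v (wsub p y a) else 0)"
  using assms by (auto simp: pauli_def dot_def wsub_def words_length fun_eq_iff)

text \<open>Phases cancel against their conjugates, and the shift only permutes the basis.\<close>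

lemma braket_pauli:
  assumes p: "0 < p" and ab: "a \<in> words p N" "b \<in> words p N"
  shows "braket p N (pauli p a b v) (pauli p a b w) = braket p N v w"
proof -
  have "braket p N (pauli p a b v) (pauli p a b w) =
      (\<Sum>y\<in>words p N. (cnj (omega p ^ dot b y) * omega p ^ dot b y) *
        (cnj (v (wsub p y a)) * w (wsub p y a)))"
    unfolding braket_def by (intro sum.cong) (auto simp: pauli_eq[OF ab] simp del: cnj_omega_power)
  also have "\<dots> = (\<Sum>y\<in>words p N. cnj (v (wsub p y a)) * w (wsub p y a))"
    by (simp only: cnj_omega_power mult_1)
  also have "\<dots> = braket p N v w"
    unfolding braket_def by (rule sum.reindex_bij_betw[OF bij_betw_wsub[OF p ab(1)]])
  finally show ?thesis .
qed

text \<open>The two products differ by the phases picked up when each shift moves past the other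
  operator's phase. Each phase is kept on its own side so that no inverse occurs; their quotient is
  given by the symplectic form.\<close>

lemma pauli_commute:
  assumes p: "0 < p" and ab: "a \<in> words p N" "b \<in> words p N" and ef: "e \<in> words p N" "f \<in> words p N"
  shows "omega p ^ dot f a * pauli p a b (pauli p e f v) y
       = omega p ^ dot b e * pauli p e f (pauli p a b v) y"
proof (cases "y \<in> words p N")
  case True
  have 1: "omega p ^ dot f a * omega p ^ dot f (wsub p y a) = omega p ^ dot f y"
    using dot_wsub_right[OF p ef(2) True ab(1)] p
    by (auto simp: add.commute simp flip: power_add intro!: omega_power_cong)
  have 2: "omega p ^ dot b e * omega p ^ dot b (wsub p y e) = omega p ^ dot b y"
    using dot_wsub_right[OF p ab(2) True ef(1)] p
    by (auto simp: add.commute simp flip: power_add intro!: omega_power_cong)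
  have "omega p ^ dot f a * pauli p a b (pauli p e f v) y
      = omega p ^ dot b y * (omega p ^ dot f a * omega p ^ dot f (wsub p y a)) *
        v (wsub p (wsub p y a) e)"
    using True by (simp add: pauli_eq[OF ab] pauli_eq[OF ef] wsub_in_words[OF p] ab)
  also have "\<dots> = omega p ^ dot f y * (omega p ^ dot b e * omega p ^ dot b (wsub p y e)) *
        v (wsub p (wsub p y e) a)"
    unfolding 1 2 using wsub_commute[OF p True ab(1) ef(1)] by simp
  also have "\<dots> = omega p ^ dot b e * pauli p e f (pauli p a b v) y"
    using True by (simp add: pauli_eq[OF ab] pauli_eq[OF ef] wsub_in_words[OF p] ef)
  finally show ?thesis .
qed (simp add: pauli_eq[OF ab] pauli_eq[OF ef])

lemma braket_scale_right: "braket p N v (\<lambda>y. c * w y) = c * braket p N v w"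
  by (simp add: braket_def sum_distrib_left mult_ac)

text \<open>The stabilizer element is unitary and fixes both vectors, so moving it past the error
  multiplies the inner product by a phase other than 1.\<close>

lemma braket_pauli_eq_0:
  assumes p: "0 < p" and ab: "a \<in> words p N" "b \<in> words p N" and ef: "e \<in> words p N" "f \<in> words p N"
    and inv: "pauli p a b v = v" "pauli p a b w = w"
    and ne: "dot f a mod p \<noteq> dot b e mod p"
  shows "braket p N v (pauli p e f w) = 0"
proof -
  have "omega p ^ dot f a * braket p N v (pauli p e f w)
      = omega p ^ dot f a * braket p N (pauli p a b v) (pauli p a b (pauli p e f w))"
    by (simp add: braket_pauli[OF p ab])
  also have "\<dots> = braket p N v (\<lambda>y. omega p ^ dot f a * pauli p a b (pauli p e f w) y)"
    by (simp add: braket_scale_right inv)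
  also have "\<dots> = omega p ^ dot b e * braket p N v (pauli p e f w)"
    by (simp only: pauli_commute[OF p ab ef] inv braket_scale_right)
  finally show ?thesis using omega_power_eq_iff[OF p] ne by simp
qed

section \<open>Stabilizer groups, cosets of shifts, and fixed vectors\<close>

text \<open>Every shift part is orthogonal to every phase part, which is more than commutation: the
  operators of \<open>S\<close> then multiply without phase factors.\<close>

locale orthogonal_stabilizer =
  fixes p N :: nat and S :: "(nat list \<times> nat list) set"
  assumes p: "0 < p"
    and S_words: "S \<subseteq> words p N \<times> words p N"
    and S_zero: "(replicate N 0, replicate N 0) \<in> S"
    and S_diff: "(a, b) \<in> S \<Longrightarrow> (a', b') \<in> S \<Longrightarrow> (wsub p a a', wsub p b b') \<in> S"
    and S_orth: "(a, b) \<in> S \<Longrightarrow> (a', b') \<in> S \<Longrightarrow> p dvd dot a b'"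
begin

definition shifts :: "nat list set" where "shifts = fst ` S"

text \<open>The diagonal elements of the group, that is, the kernel of the projection onto
  \<open>shifts\<close>.\<close>

definition phases :: "nat list set" where "phases = {b. (replicate N 0, b) \<in> S}"

text \<open>Labels of the basis vectors fixed by every diagonal element; vectors invariant under the
  whole group vanish at all other words.\<close>

definition support :: "nat list set" where
  "support = {y \<in> words p N. \<forall>b\<in>phases. p dvd dot b y}"

text \<open>The sum of all \<open>pauli a b\<close> with \<open>(a, b)\<close> in \<open>S\<close>,
  applied to the basis vector labelled \<open>r\<close>: an unnormalised projection onto the fixed
  space.\<close>

definition psi :: "nat list \<Rightarrow> qstate" where
  "psi r = (\<lambda>y. if y \<in> words p N
     then \<Sum>(a, b)\<in>S. if wsub p y a = r then omega p ^ dot b y else 0 else 0)"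

text \<open>A choice function on the classes of \<open>support\<close> modulo \<open>shifts\<close>.
  The vectors \<open>psi\<close> at distinct representatives live on disjoint cosets.\<close>

definition rep :: "nat list \<Rightarrow> nat list" where
  "rep y = (SOME r. r \<in> support \<and> wsub p r y \<in> shifts)"

lemma finite_S: "finite S"
  by (rule finite_subset[OF S_words]) simp

lemma S_D: "(a, b) \<in> S \<Longrightarrow> a \<in> words p N \<and> b \<in> words p N"
  using S_words by blast

lemma shifts_words: "shifts \<subseteq> words p N"
  using S_words by (auto simp: shifts_def)

lemma phases_words: "phases \<subseteq> words p N"
  using S_words by (auto simp: phases_def)

lemma finite_shifts: "finite shifts"
  using finite_S by (simp add: shifts_def)

lemma finite_phases: "finite phases"
  by (rule finite_subset[OF phases_words]) simp

lemma shifts_zero: "replicate N 0 \<in> shifts"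
  using S_zero by (force simp: shifts_def)

lemma shifts_diff: "a \<in> shifts \<Longrightarrow> a' \<in> shifts \<Longrightarrow> wsub p a a' \<in> shifts"
  using S_diff by (force simp: shifts_def)

lemma shifts_sym:
  assumes "x \<in> words p N" "y \<in> words p N" "wsub p x y \<in> shifts"
  shows "wsub p y x \<in> shifts"
  using shifts_diff[OF shifts_zero assms(3)] wsub_swap[OF p assms(1,2)] by simp

lemma shifts_trans:
  assumes "x \<in> words p N" "y \<in> words p N" "z \<in> words p N"
    and "wsub p x y \<in> shifts" "wsub p y z \<in> shifts"
  shows "wsub p x z \<in> shifts"
proof -
  have "wsub p (wsub p x y) (wsub p z y) = wsub p x z"
    by (rule wsub_wsub_wsub[OF p assms(1,3,2)])
  thus ?thesis using shifts_diff[OF assms(4) shifts_sym[OF assms(2,3,5)]] by simp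
qed

lemma support_words: "y \<in> support \<Longrightarrow> y \<in> words p N"
  by (simp add: support_def)

lemma zero_support: "replicate N 0 \<in> support"
  using p phases_words by (auto simp: support_def words_length)

lemma orth_shift:
  assumes "a \<in> shifts" "(a', b) \<in> S"
  shows "p dvd dot b a"
proof -
  obtain b0 where "(a, b0) \<in> S" using assms(1) by (auto simp: shifts_def)
  thus ?thesis using S_orth[OF _ assms(2)] dot_commute[of a b] S_D assms(2)
    by (metis words_length)
qed

lemma rep:
  assumes "y \<in> support"
  shows "rep y \<in> support" "wsub p (rep y) y \<in> shifts"
proof -
  have "\<exists>r. r \<in> support \<and> wsub p r y \<in> shifts"
    using assms wsub_self[OF p support_words[OF assms]] shifts_zero by auto
  from someI_ex[OF this] show "rep y \<in> support" "wsub p (rep y) y \<in> shifts"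
    unfolding rep_def by auto
qed

text \<open>The choice depends only on the defining predicate, which is the same for both words by
  transitivity.\<close>

lemma rep_eq:
  assumes "y \<in> words p N" "y' \<in> words p N" "wsub p y y' \<in> shifts"
  shows "rep y = rep y'"
proof -
  have "r \<in> support \<and> wsub p r y \<in> shifts \<longleftrightarrow> r \<in> support \<and> wsub p r y' \<in> shifts" for r
    using shifts_trans[of r y y'] shifts_trans[of r y' y] shifts_sym[OF assms] assms support_words
    by blast
  thus ?thesis unfolding rep_def by simp
qed

lemma rep_inequivalent:
  assumes "y \<in> support" "y' \<in> support" "wsub p (rep y) (rep y') \<in> shifts"
  shows "rep y = rep y'"
proof (rule rep_eq)
  note w = support_words[OF assms(1)] support_words[OF assms(2)]
    support_words[OF rep(1)[OF assms(1)]] support_words[OF rep(1)[OF assms(2)]]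
  have "wsub p y (rep y') \<in> shifts"
    using shifts_trans[of y "rep y" "rep y'"] shifts_sym[OF w(3,1) rep(2)[OF assms(1)]] w assms(3) by blast
  thus "wsub p y y' \<in> shifts"
    using shifts_trans[of y "rep y'" y'] rep(2)[OF assms(2)] w by blast
qed (use assms support_words in auto)

text \<open>Orthogonality for the group \<open>phases\<close>: off \<open>support\<close> some phase
  pairs nontrivially with \<open>y\<close>, and translating by it forces the sum to vanish.\<close>

lemma sum_characters_phases:
  assumes y: "y \<in> words p N"
  shows "(\<Sum>b\<in>phases. omega p ^ dot b y) = (if y \<in> support then of_nat (card phases) else 0)"
proof (cases "y \<in> support")
  case True
  have "(\<Sum>b\<in>phases. omega p ^ dot b y) = (\<Sum>b\<in>phases. 1)"
    using True omega_power_eq_1_iff[OF p] by (intro sum.cong) (auto simp: support_def)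
  thus ?thesis using True by simp
next
  case False
  then obtain c where c: "c \<in> phases" "\<not> p dvd dot c y" using y by (auto simp: support_def)
  have bij: "bij_betw (\<lambda>b. wsub p b c) phases phases"
    unfolding bij_betw_def
  proof
    show inj: "inj_on (\<lambda>b. wsub p b c) phases"
      using inj_on_wsub[OF p] c(1) phases_words inj_on_subset by blast
    have "wsub p b c \<in> phases" if "b \<in> phases" for b
      using S_diff[of "replicate N 0" b "replicate N 0" c] that c(1) wsub_self[OF p zero_in_words[OF p, of N]]
      by (simp add: phases_def)
    thus "(\<lambda>b. wsub p b c) ` phases = phases"
      by (intro endo_inj_surj finite_phases inj) auto
  qed
  have "(\<Sum>b\<in>phases. omega p ^ dot b y) = 0"
  proof (rule sum_eq_0_if_twisted[OF bij])
    fix b assume "b \<in> phases"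
    hence "omega p ^ (dot (wsub p b c) y + dot c y) = omega p ^ dot b y"
      using dot_wsub_left[OF p _ _ y] c(1) phases_words by (intro omega_power_cong p) auto
    thus "omega p ^ dot (wsub p b c) y = inverse (omega p ^ dot c y) * omega p ^ dot b y"
      by (auto simp: power_add field_simps)
  next
    show "inverse (omega p ^ dot c y) \<noteq> 1"
      using c(2) omega_power_eq_1_iff[OF p] by auto
  qed
  thus ?thesis using False by simp
qed

text \<open>Duality between a code and its annihilator, obtained by evaluating the double character
  sum over words and phases in both orders.\<close>

lemma card_support: "card phases * card support = p ^ N"
proof -
  have z: "replicate N 0 \<in> phases" using S_zero by (simp add: phases_def)
  have "(of_nat (card phases * card support) :: complex)
      = (\<Sum>y\<in>words p N. if y \<in> support then of_nat (card phases) else 0)"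
    using support_words by (subst sum.If_cases) (auto simp: Int_absorb1 subset_iff Int_def intro!: arg_cong[where f = card])
  also have "\<dots> = (\<Sum>y\<in>words p N. \<Sum>b\<in>phases. omega p ^ dot b y)"
    by (simp add: sum_characters_phases)
  also have "\<dots> = (\<Sum>b\<in>phases. \<Sum>y\<in>words p N. omega p ^ dot b y)"
    by (rule sum.swap)
  also have "\<dots> = (\<Sum>b\<in>phases. if b = replicate N 0 then of_nat (p ^ N) else 0)"
    using phases_words by (intro sum.cong sum_characters_words p) auto
  also have "\<dots> = of_nat (p ^ N)"
    using z finite_phases by simp
  finally show ?thesis by (simp only: of_nat_eq_iff)
qed

text \<open>A lift \<open>g\<close> of each shift to \<open>S\<close> combines with the phases: the
  pairs \<open>(a, wsub p (g a) b)\<close> are distinct elements of \<open>S\<close>.\<close>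

lemma card_shifts_phases: "card shifts * card phases \<le> card S"
proof -
  have "\<forall>a\<in>shifts. \<exists>b. (a, b) \<in> S" by (auto simp: shifts_def)
  from bchoice[OF this] obtain g where g: "(a, g a) \<in> S" if "a \<in> shifts" for a by blast
  have "inj_on (\<lambda>(a, b). (a, wsub p (g a) b)) (shifts \<times> phases)"
  proof -
    have "b = b'" if *: "a \<in> shifts" "b \<in> phases" "b' \<in> phases" "wsub p (g a) b = wsub p (g a) b'"
      for a b b'
      using inj_onD[OF inj_on_wsub_right[OF p] *(4)] g[OF *(1)] *(2,3) S_D phases_words by blast
    thus ?thesis by (auto simp: inj_on_def)
  qed
  moreover have "(\<lambda>(a, b). (a, wsub p (g a) b)) ` (shifts \<times> phases) \<subseteq> S"
  proof -
    have "(a, wsub p (g a) b) \<in> S" if *: "a \<in> shifts" "b \<in> phases" for a b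
    proof -
      have "wsub p a (replicate N 0) = a" using wsub_zero[OF p] shifts_words *(1) by blast
      thus ?thesis using S_diff[OF g[OF *(1)], of "replicate N 0" b] *(2) by (simp add: phases_def)
    qed
    thus ?thesis by auto
  qed
  ultimately have "card (shifts \<times> phases) \<le> card S"
    by (rule card_inj_on_le[OF _ _ finite_S])
  thus ?thesis by (simp add: card_cartesian_product)
qed

text \<open>The cosets of \<open>shifts\<close> through the representatives cover
  \<open>support\<close>, so \<open>card_support\<close> and \<open>card_shifts_phases\<close> bound
  the number of representatives from below. This number is the available dimension.\<close>

lemma card_reps: "p ^ N \<le> card (rep ` support) * card S"
proof -
  have fin: "finite support" by (simp add: support_def)
  have "support \<subseteq> (\<Union>r\<in>rep ` support. wsub p r ` shifts)"
  proof
    fix y assume y: "y \<in> support"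
    have "y = wsub p (rep y) (wsub p (rep y) y)"
      using wsub_cancel[OF p support_words[OF rep(1)[OF y]] support_words[OF y]] by simp
    thus "y \<in> (\<Union>r\<in>rep ` support. wsub p r ` shifts)"
      using rep[OF y] y by blast
  qed
  hence "card support \<le> card (\<Union>r\<in>rep ` support. wsub p r ` shifts)"
    using fin finite_shifts by (intro card_mono) auto
  also have "\<dots> \<le> (\<Sum>r\<in>rep ` support. card (wsub p r ` shifts))"
    using fin by (intro card_UN_le) auto
  also have "\<dots> \<le> (\<Sum>r\<in>rep ` support. card shifts)"
    by (intro sum_mono card_image_le finite_shifts)
  finally have "card support \<le> card (rep ` support) * card shifts" by simp
  hence "p ^ N \<le> card (rep ` support) * (card shifts * card phases)"
    unfolding card_support[symmetric] by (metis mult.assoc mult.commute mult_le_mono1)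
  also have "\<dots> \<le> card (rep ` support) * card S"
    using card_shifts_phases by simp
  finally show ?thesis .
qed

lemma psi_state: "is_state p N (psi r)"
  by (simp add: is_state_def psi_def)

text \<open>Multiplication by a group element permutes the summands of \<open>psi\<close>;
  orthogonality of shifts and phases means that no extra phase appears.\<close>

lemma psi_invariant:
  assumes S: "(a', b') \<in> S"
  shows "pauli p a' b' (psi r) = psi r"
proof
  fix y
  have w: "a' \<in> words p N" "b' \<in> words p N" using S S_D by auto
  have bij: "bij_betw (\<lambda>(a, b). (wsub p a a', wsub p b b')) S S"
    unfolding bij_betw_def
  proof
    show inj: "inj_on (\<lambda>(a, b). (wsub p a a', wsub p b b')) S"
    proof -
      have "a = c \<and> b = d"
        if *: "(a, b) \<in> S" "(c, d) \<in> S" "wsub p a a' = wsub p c a'" "wsub p b b' = wsub p d b'" for a b c d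
        using inj_onD[OF inj_on_wsub[OF p w(1)] *(3)] inj_onD[OF inj_on_wsub[OF p w(2)] *(4)] *(1,2) S_D by blast
      thus ?thesis by (auto simp: inj_on_def)
    qed
    show "(\<lambda>(a, b). (wsub p a a', wsub p b b')) ` S = S"
      by (intro endo_inj_surj finite_S inj) (auto intro: S_diff S)
  qed
  show "pauli p a' b' (psi r) y = psi r y"
  proof (cases "y \<in> words p N")
    case True
    have "(\<Sum>(a, b)\<in>S. if wsub p (wsub p y a') a = r then omega p ^ dot b (wsub p y a') else 0)
        = (\<Sum>(a, b)\<in>S. if wsub p (wsub p y a') (wsub p a a') = r
            then omega p ^ dot (wsub p b b') (wsub p y a') else 0)"
      by (subst sum.reindex_bij_betw[OF bij, symmetric]) (simp add: case_prod_unfold cong: if_cong)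
    also have "omega p ^ dot b' y * \<dots> = (\<Sum>(a, b)\<in>S. if wsub p y a = r then omega p ^ dot b y else 0)"
      unfolding sum_distrib_left
    proof (intro sum.cong refl, clarify)
      fix a b assume ab: "(a, b) \<in> S"
      note w' = S_D[OF ab]
      have d: "(wsub p a a', wsub p b b') \<in> S" by (rule S_diff[OF ab S])
      have "wsub p b b' \<in> words p N" using d S_D by blast
      moreover have "p dvd dot (wsub p b b') a'"
        using orth_shift[OF _ d] S by (force simp: shifts_def)
      ultimately have "dot (wsub p b b') (wsub p y a') mod p = dot (wsub p b b') y mod p"
        using dot_wsub_right[OF p _ True w(1), of "wsub p b b'"] by auto
      hence "(dot b' y + dot (wsub p b b') (wsub p y a')) mod p = (dot b' y + dot (wsub p b b') y) mod p"
        by (rule mod_add_cong[OF refl])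
      also have "\<dots> = dot b y mod p"
        using dot_wsub_left[OF p _ w(2) True, of b] w' by (simp add: add.commute)
      finally have "(dot b' y + dot (wsub p b b') (wsub p y a')) mod p = dot b y mod p" .
      hence "omega p ^ dot b' y * omega p ^ dot (wsub p b b') (wsub p y a') = omega p ^ dot b y"
        unfolding power_add[symmetric] by (rule omega_power_cong[OF p])
      thus "omega p ^ dot b' y * (if wsub p (wsub p y a') (wsub p a a') = r
            then omega p ^ dot (wsub p b b') (wsub p y a') else 0) = (if wsub p y a = r then omega p ^ dot b y else 0)"
        using wsub_wsub_wsub[OF p True _ w(1)] w' by simp
    qed
    finally show ?thesis
      using True w by (simp add: pauli_eq[OF w] psi_def wsub_in_words[OF p])
  qed (simp add: pauli_eq[OF w] psi_def)
qed

lemma psi_support: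
  assumes "psi r y \<noteq> 0"
  shows "y \<in> words p N \<and> wsub p y r \<in> shifts"
proof -
  have y: "y \<in> words p N" using assms by (auto simp: psi_def split: if_splits)
  then obtain ab where "ab \<in> S" "(case ab of (a, b) \<Rightarrow> if wsub p y a = r then omega p ^ dot b y else 0) \<noteq> 0"
    using assms unfolding psi_def by (metis (mono_tags, lifting) sum.neutral)
  then obtain a b where ab: "(a, b) \<in> S" "wsub p y a = r" by (auto split: if_splits prod.splits)
  hence "wsub p y r = a" using wsub_cancel[OF p y, of a] S_D by auto
  thus ?thesis using ab y by (force simp: shifts_def)
qed

text \<open>At \<open>r\<close> itself only diagonal elements contribute, and each contributes 1
  because \<open>r\<close> lies in \<open>support\<close>.\<close>

lemma psi_self:
  assumes r: "r \<in> support"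
  shows "psi r r = of_nat (card phases)" "psi r r \<noteq> 0"
proof -
  have rw: "r \<in> words p N" using r support_words by simp
  have eq: "wsub p r a = r \<longleftrightarrow> a = replicate N 0" if "(a, b) \<in> S" for a b
    using that S_D wsub_cancel[OF p rw, of a] wsub_self[OF p rw] wsub_zero[OF p rw] by force
  have "psi r r = (\<Sum>(a, b)\<in>S. if a = replicate N 0 then omega p ^ dot b r else 0)"
    using rw eq by (auto simp: psi_def intro!: sum.cong)
  also have "\<dots> = (\<Sum>(a, b)\<in>Pair (replicate N (0::nat)) ` phases. omega p ^ dot b r)"
    by (rule sum.mono_neutral_cong_right) (auto simp: phases_def finite_S)
  also have "\<dots> = (\<Sum>b\<in>phases. omega p ^ dot b r)"
    by (subst sum.reindex) (auto simp: inj_on_def)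
  finally show "psi r r = of_nat (card phases)"
    using r rw by (simp add: sum_characters_phases)
  moreover have "replicate N 0 \<in> phases" using S_zero by (simp add: phases_def)
  ultimately show "psi r r \<noteq> 0" using finite_phases by auto
qed

end

section \<open>The stabilizer code and its exact distance\<close>

lemma pauli_lin_comb:
  assumes "a \<in> words p N" "b \<in> words p N"
  shows "pauli p a b (lin_comb m vs c) = lin_comb m (\<lambda>i. pauli p a b (vs i)) c"
  by (auto simp: pauli_eq[OF assms] lin_comb_def sum_distrib_left mult_ac fun_eq_iff)

lemma basis_vector_in_range_lin_comb:
  assumes "i < m"
  shows "vs i \<in> range (lin_comb m vs)"
proof -
  have "vs i = lin_comb m vs (\<lambda>j. if j = i then 1 else 0)"
    using assms by (simp add: lin_comb_def fun_eq_iff if_distrib[of "\<lambda>x. x * _"] cong: if_cong)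
  thus ?thesis by (metis rangeI)
qed

lemma qweight_eq_0D:
  assumes "qweight a b = 0" "a \<in> words p N" "b \<in> words p N"
  shows "a = replicate N 0" "b = replicate N 0"
  using assms by (auto simp: qweight_def words_length intro!: nth_equalityI)

lemma braket_self_ne_0:
  assumes "v y \<noteq> 0" "y \<in> words p N"
  shows "braket p N v v \<noteq> 0"
proof
  assume "braket p N v v = 0"
  moreover have "braket p N v v = of_real (\<Sum>x\<in>words p N. (cmod (v x))\<^sup>2)"
    unfolding braket_def of_real_sum
    by (intro sum.cong refl) (metis complex_norm_square mult.commute)
  ultimately have "(\<Sum>x\<in>words p N. (cmod (v x))\<^sup>2) = 0" by (metis of_real_eq_0_iff)
  hence "(cmod (v y))\<^sup>2 = 0" using assms(2) by (subst (asm) sum_nonneg_eq_0_iff) auto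
  thus False using assms(1) by simp
qed

context orthogonal_stabilizer
begin

lemma dot_cong_of_equivalent:
  assumes z: "z \<in> words p N" "\<And>a. a \<in> shifts \<Longrightarrow> p dvd dot z a"
    and x: "x \<in> words p N" "x' \<in> words p N" "wsub p x x' \<in> shifts"
  shows "dot z x mod p = dot z x' mod p"
  using dot_wsub_right[OF p z(1) x(1,2)] z(2)[OF x(3)] by auto

text \<open>\<open>psi r\<close> lives on one coset of \<open>shifts\<close>, on which a
  \<open>z\<close> orthogonal to all shifts has constant scalar product modulo
  \<open>p\<close>.\<close>

lemma phase_error_psi:
  assumes z: "z \<in> words p N" "\<And>a. a \<in> shifts \<Longrightarrow> p dvd dot z a" and r: "r \<in> words p N"
  shows "pauli p (replicate N 0) z (psi r) = (\<lambda>y. omega p ^ dot z r * psi r y)"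
proof
  fix y
  show "pauli p (replicate N 0) z (psi r) y = omega p ^ dot z r * psi r y"
  proof (cases "psi r y = 0")
    case False
    from psi_support[OF this] have y: "y \<in> words p N" "wsub p y r \<in> shifts" by auto
    have "omega p ^ dot z y = omega p ^ dot z r"
      by (rule omega_power_cong[OF p dot_cong_of_equivalent[OF z y(1) r y(2)]])
    thus ?thesis using y(1) p z(1) by (simp add: pauli_eq[where N = N] wsub_zero)
  qed (use p z(1) in \<open>simp add: pauli_eq[where N = N] wsub_zero\<close>)
qed

text \<open>Counting representatives provides at least \<open>p ^ K\<close> independent fixed
  vectors. The phase error \<open>z\<close> bounds the distance from above: these vectors are
  eigenvectors of it, and the class of \<open>y\<close> ensures that two eigenvalues differ.
  Hypothesis \<open>anti\<close> gives purity and detection below weight \<open>d\<close>.\<close>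

theorem stabilizer_code:
  assumes card: "card S * p ^ K \<le> p ^ N" and K: "2 \<le> p ^ K"
    and z: "z \<in> words p N" "\<And>a b. (a, b) \<in> S \<Longrightarrow> p dvd dot z a"
    and y: "y \<in> words p N" "\<And>a b. (a, b) \<in> S \<Longrightarrow> p dvd dot b y"
    and zy: "\<not> p dvd dot z y"
    and wt: "qweight (replicate N 0) z = d"
    and anti: "\<And>e f. e \<in> words p N \<Longrightarrow> f \<in> words p N \<Longrightarrow> 1 \<le> qweight e f \<Longrightarrow> qweight e f < d \<Longrightarrow>
      \<exists>(a, b)\<in>S. dot f a mod p \<noteq> dot b e mod p"
  shows "\<exists>Q. quantum_code p N K d Q \<and> pure_code p N d Q"
proof -
  have z': "p dvd dot z a" if "a \<in> shifts" for a using that z(2) by (auto simp: shifts_def)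
  have ys: "y \<in> support" using y by (auto simp: support_def phases_def)
  define r0 where "r0 = rep (replicate N 0)"
  define r1 where "r1 = rep y"
  note w0 = support_words[OF rep(1)[OF zero_support], folded r0_def]
  note w1 = support_words[OF rep(1)[OF ys], folded r1_def]
  have d0: "dot z r0 mod p = 0"
    using dot_cong_of_equivalent[OF z(1) z' w0 support_words[OF zero_support]]
      rep(2)[OF zero_support] z(1) by (simp add: r0_def words_length)
  have d1: "dot z r1 mod p \<noteq> 0"
    using dot_cong_of_equivalent[OF z(1) z' w1 y(1)] rep(2)[OF ys] zy by (simp add: r1_def dvd_eq_mod_eq_0)
  have r01: "r0 \<noteq> r1" using d0 d1 by metis
  have fin: "finite (rep ` support)" by (simp add: support_def)
  have "card S * p ^ K \<le> card S * card (rep ` support)"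
    using order.trans[OF card card_reps] by (simp add: mult.commute)
  moreover have "card S > 0" using S_zero finite_S card_gt_0_iff by blast
  ultimately have "p ^ K \<le> card (rep ` support)" by simp
  \<comment> \<open>Exactly \<open>p ^ K\<close> representatives are kept, among them those of zero
    and of \<open>y\<close>, so that two different eigenvalues of \<open>z\<close> survive in
    \<open>Q\<close>; \<open>2 \<le> p ^ K\<close> leaves room for both.\<close>
  then obtain R where R: "{r0, r1} \<subseteq> R" "R \<subseteq> rep ` support" "card R = p ^ K"
    using exists_subset_between[of "{r0, r1}" "p ^ K" "rep ` support"] r01 K fin zero_support ys
    by (auto simp: r0_def r1_def)
  have finR: "finite R" using R(2) fin finite_subset by blast
  obtain g where g: "bij_betw g {..<p ^ K} R"
    using ex_bij_betw_nat_finite[OF finR] R(3) by (auto simp: atLeast0LessThan)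
  have gR: "g i \<in> R" if "i < p ^ K" for i using g that by (auto simp: bij_betw_def)
  have Rsup: "R \<subseteq> support" using R(2) rep(1) by blast
  define vs where "vs = (\<lambda>i. psi (g i))"
  define Q where "Q = range (lin_comb (p ^ K) vs)"
  have psi_Q: "psi r \<in> Q" if r: "r \<in> R" for r
  proof -
    obtain i where "i < p ^ K" "g i = r" using g r by (auto simp: bij_betw_def)
    thus ?thesis
      using basis_vector_in_range_lin_comb[of i "p ^ K" vs] by (simp add: Q_def vs_def)
  qed
  have inv: "pauli p a b v = v" if ab: "(a, b) \<in> S" and v: "v \<in> Q" for a b v
  proof -
    obtain c where "v = lin_comb (p ^ K) vs c" using v by (auto simp: Q_def)
    thus ?thesis using ab S_D[OF ab]
      by (simp add: pauli_lin_comb[where N = N] vs_def psi_invariant)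
  qed
  \<comment> \<open>Distinct representatives lie in different cosets, so \<open>psi r\<close>
    vanishes at \<open>r'\<close>; evaluation at \<open>g i\<close> then isolates one
    coefficient.\<close>
  have off: "psi r r' = 0" if R': "r \<in> R" "r' \<in> R" "r \<noteq> r'" for r r'
  proof (rule ccontr)
    assume "psi r r' \<noteq> 0"
    hence "wsub p r' r \<in> shifts" using psi_support by blast
    moreover obtain x x' where "x \<in> support" "r = rep x" "x' \<in> support" "r' = rep x'"
      using R'(1,2) R(2) by blast
    ultimately show False using rep_inequivalent[of x' x] R'(3) by metis
  qed
  have "lin_indep (p ^ K) vs"
    unfolding lin_indep_def
  proof (intro allI impI)
    fix c i assume c: "lin_comb (p ^ K) vs c = (\<lambda>_. 0)" and i: "i < p ^ K"
    have "0 = (\<Sum>j<p ^ K. c j * psi (g j) (g i))"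
      using fun_cong[OF c, of "g i"] by (simp add: lin_comb_def vs_def)
    also have "\<dots> = (\<Sum>j<p ^ K. if j = i then c j * psi (g i) (g i) else 0)"
    proof (intro sum.cong refl)
      fix j assume j: "j \<in> {..<p ^ K}"
      have "psi (g j) (g i) = 0" if "j \<noteq> i"
        using off gR[of j] gR[OF i] inj_onD[OF bij_betw_imp_inj_on[OF g], of j i] i j that by auto
      thus "c j * psi (g j) (g i) = (if j = i then c j * psi (g i) (g i) else 0)" by simp
    qed
    also have "\<dots> = c i * psi (g i) (g i)" using i by simp
    finally show "c i = 0" using psi_self(2) gR[OF i] Rsup by auto
  qed
  hence dim: "subspace_dim p N (p ^ K) Q"
    unfolding subspace_dim_def Q_def by (intro exI[of _ vs]) (simp add: vs_def psi_state)
  have zero: "braket p N v1 (pauli p e f v2) = 0"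
    if ef: "e \<in> words p N" "f \<in> words p N" "1 \<le> qweight e f" "qweight e f < d"
      and v: "v1 \<in> Q" "v2 \<in> Q" for e f v1 v2
  proof -
    obtain a b where ab: "(a, b) \<in> S" "dot f a mod p \<noteq> dot b e mod p"
      using anti[OF ef] by blast
    show ?thesis
      using braket_pauli_eq_0[OF p _ _ ef(1,2) inv[OF ab(1) v(1)] inv[OF ab(1) v(2)] ab(2)]
        S_D[OF ab(1)] by blast
  qed
  have det: "detects p N Q e f" if ef: "e \<in> words p N" "f \<in> words p N" "qweight e f < d" for e f
  proof (cases "qweight e f = 0")
    case True
    note e = qweight_eq_0D[OF True ef(1,2)]
    have "braket p N v1 (pauli p e f v2) = 1 * braket p N v1 v2" for v1 v2
      unfolding braket_def using ef(1,2) p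
      by (auto simp: pauli_eq[where N = N] e wsub_zero intro!: sum.cong)
    thus ?thesis unfolding detects_def by blast
  next
    case False
    thus ?thesis using zero[OF ef(1,2) _ ef(3)] unfolding detects_def
      by (intro exI[of _ 0]) auto
  qed
  have "\<not> detects p N Q (replicate N 0) z"
  proof
    assume "detects p N Q (replicate N 0) z"
    then obtain c where c: "\<And>v. v \<in> Q \<Longrightarrow>
        braket p N v (pauli p (replicate N 0) z v) = c * braket p N v v"
      unfolding detects_def by blast
    \<comment> \<open>Detection would force the single eigenvalue \<open>c\<close> on all chosen
      vectors.\<close>
    have "omega p ^ dot z r = c" if r: "r \<in> R" for r
    proof -
      have rs: "r \<in> support" using r Rsup by blast
      have "omega p ^ dot z r * braket p N (psi r) (psi r) = c * braket p N (psi r) (psi r)"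
        using c[OF psi_Q[OF r]] phase_error_psi[OF z(1) z' support_words[OF rs]]
        by (simp add: braket_scale_right)
      moreover have "braket p N (psi r) (psi r) \<noteq> 0"
        by (rule braket_self_ne_0[of "psi r" r, OF psi_self(2)[OF rs] support_words[OF rs]])
      ultimately show ?thesis by simp
    qed
    hence "omega p ^ dot z r0 = omega p ^ dot z r1" using R(1) by auto
    thus False using d0 d1 omega_power_eq_iff[OF p] by metis
  qed
  hence "quantum_code p N K d Q"
    unfolding quantum_code_def using dim det wt z(1) zero_in_words[OF p] by blast
  moreover have "pure_code p N d Q"
    unfolding pure_code_def using zero by auto
  ultimately show ?thesis by blast
qed

end

section \<open>From point sets over F_9 to stabilizer codes\<close>

lemma dot_map_map:
  assumes "distinct xs"
  shows "dot (map f xs) (map g xs) = (\<Sum>x\<in>set xs. f x * g x)"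
  unfolding dot_def length_map
  by (subst sum.reindex_bij_betw[OF bij_betw_nth[OF assms refl refl], of "\<lambda>x. f x * g x", symmetric]) simp

lemma dot_map_mod_right: "dot f (map (\<lambda>x. g x mod p) xs) mod p = dot f (map g xs) mod p"
  if "length f = length xs"
proof -
  have "(\<Sum>i<length xs. (f ! i * (g (xs ! i) mod p)) mod p) mod p
      = (\<Sum>i<length xs. (f ! i * g (xs ! i)) mod p) mod p"
    by (simp add: mod_mult_right_eq)
  thus ?thesis using that by (simp add: dot_def mod_sum_eq)
qed

lemma dot_map_mod_left:
  assumes "length e = length xs"
  shows "dot (map (\<lambda>x. g x mod p) xs) e mod p = dot (map g xs) e mod p"
  using dot_map_mod_right[OF assms, of g p] assms by (metis dot_commute length_map)

lemma dot_map_two_columns: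
  assumes "length f = length xs" "j < length xs" "k < length xs" "j \<noteq> k"
    and "\<And>i. i < length xs \<Longrightarrow> i \<noteq> j \<Longrightarrow> i \<noteq> k \<Longrightarrow> f ! i = 0"
  shows "dot f (map g xs) = f ! j * g (xs ! j) + f ! k * g (xs ! k)"
proof -
  have "dot f (map g xs) = (\<Sum>i\<in>{j, k}. f ! i * g (xs ! i))"
    unfolding dot_def using assms by (intro sum.mono_neutral_cong_right) auto
  thus ?thesis using assms(4) by simp
qed

text \<open>A point \<open>(u, w)\<close> stands for \<open>u + i w\<close> in \<open>F\<^sub>9\<^sup>m\<close>. The functional with coefficient vector
  \<open>\<alpha> + i \<beta>\<close> takes the value \<open>shift_coord + i phase_coord\<close> on it.\<close>

definition shift_coord :: "nat list \<times> nat list \<Rightarrow> nat list \<times> nat list \<Rightarrow> nat" where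
  "shift_coord l x = dot (fst l) (fst x) + 2 * dot (snd l) (snd x)"

definition phase_coord :: "nat list \<times> nat list \<Rightarrow> nat list \<times> nat list \<Rightarrow> nat" where
  "phase_coord l x = dot (snd l) (fst x) + dot (fst l) (snd x)"

text \<open>Since 2 stands for -1, the premises of \<open>indep\<close> are the real and imaginary
  parts of \<open>(f + i e) (u + i w) + (f' + i e') (u' + i w') = 0\<close>: any two distinct points
  are linearly independent over F_9. Condition \<open>orth\<close> supplies the orthogonality
  required by \<open>orthogonal_stabilizer\<close>.\<close>

locale orthogonal_point_set =
  fixes m :: nat and X :: "(nat list \<times> nat list) set"
  assumes X_words: "X \<subseteq> words 3 m \<times> words 3 m"
    and orth: "l \<in> words 3 m \<times> words 3 m \<Longrightarrow> l' \<in> words 3 m \<times> words 3 m \<Longrightarrow>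
      3 dvd (\<Sum>x\<in>X. shift_coord l x * phase_coord l' x)"
    and indep: "(u, w) \<in> X \<Longrightarrow> (u', w') \<in> X \<Longrightarrow> (u, w) \<noteq> (u', w') \<Longrightarrow>
      f < 3 \<Longrightarrow> e < 3 \<Longrightarrow> f' < 3 \<Longrightarrow> e' < 3 \<Longrightarrow>
      (\<And>r. r < m \<Longrightarrow> 3 dvd f * u ! r + f' * u' ! r + 2 * (e * w ! r + e' * w' ! r)) \<Longrightarrow>
      (\<And>r. r < m \<Longrightarrow> 3 dvd f * w ! r + f' * w' ! r + (e * u ! r + e' * u' ! r)) \<Longrightarrow>
      f = 0 \<and> f' = 0 \<and> e = 0 \<and> e' = 0"
begin

definition columns :: "(nat list \<times> nat list) list" where
  "columns = (SOME xs. set xs = X \<and> distinct xs)"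

definition stabilizer :: "(nat list \<times> nat list) set" where
  "stabilizer = (\<lambda>l. (map (\<lambda>x. shift_coord l x mod 3) columns, map (\<lambda>x. phase_coord l x mod 3) columns))
     ` (words 3 m \<times> words 3 m)"

lemma finite_X: "finite X"
  by (rule finite_subset[OF X_words]) simp

lemma columns: "set columns = X" "distinct columns" "length columns = card X"
proof -
  show *: "set columns = X" "distinct columns"
    using someI_ex[OF finite_distinct_list[OF finite_X]] unfolding columns_def by auto
  show "length columns = card X" using distinct_card[OF *(2)] *(1) by simp
qed

lemma nth_columns: "i < length columns \<Longrightarrow> columns ! i \<in> X"
  using nth_mem[of i columns] columns(1) by simp

text \<open>Coordinates are additive in the functional, which makes \<open>stabilizer\<close> closed
  under differences.\<close>

lemma coord_diff:
  assumes "l \<in> words 3 m \<times> words 3 m" "l' \<in> words 3 m \<times> words 3 m" "x \<in> X"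
  shows "(shift_coord l x mod 3 + 3 - shift_coord l' x mod 3) mod 3
      = shift_coord (wsub 3 (fst l) (fst l'), wsub 3 (snd l) (snd l')) x mod 3" (is ?A)
    and "(phase_coord l x mod 3 + 3 - phase_coord l' x mod 3) mod 3
      = phase_coord (wsub 3 (fst l) (fst l'), wsub 3 (snd l) (snd l')) x mod 3" (is ?B)
proof -
  have w: "fst l \<in> words 3 m" "snd l \<in> words 3 m" "fst l' \<in> words 3 m" "snd l' \<in> words 3 m"
    "fst x \<in> words 3 m" "snd x \<in> words 3 m"
    using assms X_words by auto
  have "0 < (3::nat)" by simp
  note d = dot_wsub_left[OF this w(1,3,5)] dot_wsub_left[OF this w(1,3,6)]
    dot_wsub_left[OF this w(2,4,5)] dot_wsub_left[OF this w(2,4,6)]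
  \<comment> \<open>Turns a congruence between sums, as delivered by \<open>dot_wsub_left\<close>,
    into one for the guarded natural-number difference.\<close>
  have arith: "(a mod 3 + 3 - b mod 3) mod 3 = c mod 3" if "(c + b) mod 3 = a mod 3" for a b c :: nat
  proof -
    have "b mod 3 \<le> a mod 3 + 3" using mod_less_divisor[of 3 b] by linarith
    hence "int ((a mod 3 + 3 - b mod 3) mod 3) = (int a mod 3 + 3 - int b mod 3) mod 3"
      by (simp only: of_nat_mod of_nat_diff of_nat_add of_nat_numeral)
    also have "\<dots> = (int a mod 3 - int b mod 3 + 3) mod 3" by (simp only: diff_add_eq)
    also have "\<dots> = (int a - int b) mod 3" by (simp only: mod_add_self2 mod_diff_eq)
    also have "\<dots> = (int (c + b) - int b) mod 3"
      using arg_cong[OF that, of int] by (intro mod_diff_cong refl) (simp only: of_nat_mod of_nat_numeral)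
    also have "\<dots> = int (c mod 3)" by (simp add: of_nat_mod)
    finally show ?thesis by (simp only: of_nat_eq_iff)
  qed
  show ?A unfolding shift_coord_def fst_conv snd_conv
    using mod_add_cong[OF d(1) mod_mult_cong[OF refl d(4), of 2]]
    by (rule arith[OF trans[OF arg_cong[where f = "\<lambda>x. x mod 3"]], rotated]) simp
  show ?B unfolding phase_coord_def fst_conv snd_conv
    using mod_add_cong[OF d(3) d(2)]
    by (rule arith[OF trans[OF arg_cong[where f = "\<lambda>x. x mod 3"]], rotated]) simp
qed

sublocale orthogonal_stabilizer 3 "card X" stabilizer
proof
  show "stabilizer \<subseteq> words 3 (card X) \<times> words 3 (card X)"
    by (auto simp: stabilizer_def in_words_iff columns)
  have "(replicate m 0, replicate m 0) \<in> words 3 m \<times> words 3 m" by simp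
  moreover have "map (\<lambda>x. shift_coord (replicate m 0, replicate m 0) x mod 3) columns = replicate (card X) 0"
    "map (\<lambda>x. phase_coord (replicate m 0, replicate m 0) x mod 3) columns = replicate (card X) 0"
    by (simp_all add: shift_coord_def phase_coord_def map_replicate_const columns)
  ultimately show "(replicate (card X) 0, replicate (card X) 0) \<in> stabilizer"
    unfolding stabilizer_def by (intro image_eqI[where x = "(replicate m 0, replicate m 0)"]) simp_all
next
  fix a b a' b' assume "(a, b) \<in> stabilizer" "(a', b') \<in> stabilizer"
  then obtain l l' where l: "l \<in> words 3 m \<times> words 3 m" "l' \<in> words 3 m \<times> words 3 m"
    and a: "a = map (\<lambda>x. shift_coord l x mod 3) columns" "a' = map (\<lambda>x. shift_coord l' x mod 3) columns"
    and b: "b = map (\<lambda>x. phase_coord l x mod 3) columns" "b' = map (\<lambda>x. phase_coord l' x mod 3) columns"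
    unfolding stabilizer_def by blast
  define k where "k = (wsub 3 (fst l) (fst l'), wsub 3 (snd l) (snd l'))"
  have "k \<in> words 3 m \<times> words 3 m" using l by (auto simp: k_def intro!: wsub_in_words)
  moreover have "wsub 3 a a' = map (\<lambda>x. shift_coord k x mod 3) columns"
    "wsub 3 b b' = map (\<lambda>x. phase_coord k x mod 3) columns"
    unfolding a b k_def
    by (rule nth_equalityI; simp add: nth_wsub coord_diff[OF l] nth_columns)+
  ultimately show "(wsub 3 a a', wsub 3 b b') \<in> stabilizer"
    unfolding stabilizer_def by (intro image_eqI[where x = k]) simp_all
  have "dot a b' mod 3 = dot (map (shift_coord l) columns) (map (phase_coord l') columns) mod 3"
    unfolding a b by (simp add: dot_map_mod_left dot_map_mod_right)
  also have "\<dots> = 0"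
    using orth[OF l] by (simp add: dot_map_map columns)
  finally show "3 dvd dot a b'" by (simp add: dvd_eq_mod_eq_0)
qed simp

lemma card_stabilizer: "card stabilizer \<le> 3 ^ (2 * m)"
proof -
  have "card stabilizer \<le> card (words 3 m \<times> words 3 m)"
    unfolding stabilizer_def by (intro card_image_le) simp
  thus ?thesis by (simp add: card_cartesian_product card_words mult_2 power_add)
qed

text \<open>The entries of an error commuting with every stabilizer element are the coefficients of
  an F_9-linear relation between the at most two points it touches, against
  \<open>indep\<close>.\<close>

lemma detects_weight_le_2:
  assumes ef: "e \<in> words 3 (card X)" "f \<in> words 3 (card X)" "1 \<le> qweight e f" "qweight e f < 3"
    and card: "2 \<le> card X"
  shows "\<exists>(a, b)\<in>stabilizer. dot f a mod 3 \<noteq> dot b e mod 3"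
proof (rule ccontr)
  assume neg: "\<not> ?thesis"
  define W where "W = {i. i < card X \<and> (e ! i \<noteq> 0 \<or> f ! i \<noteq> 0)}"
  have cW: "card W = 1 \<or> card W = 2"
    using ef by (auto simp: qweight_def words_length W_def)
  \<comment> \<open>For weight one a second column with zero entries is added, so that both weights
    give a relation between two distinct points.\<close>
  have "\<exists>j k. j < card X \<and> k < card X \<and> j \<noteq> k \<and> W \<subseteq> {j, k}"
    using cW
  proof
    assume "card W = 1"
    then obtain j where j: "W = {j}" by (rule card_1_singletonE)
    define k where "k = (if j = 0 then 1 else 0 :: nat)"
    have "j < card X" using j by (auto simp: W_def)
    moreover have "k < card X" "j \<noteq> k" using card by (auto simp: k_def)
    ultimately show ?thesis using j by blast
  next
    assume "card W = 2"
    then obtain j k where "W = {j, k}" "j \<noteq> k" unfolding card_2_iff by blast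
    moreover have "j < card X" "k < card X" using calculation(1) by (auto simp: W_def)
    ultimately show ?thesis by blast
  qed
  then obtain j k where jk: "j < card X" "k < card X" "j \<noteq> k" "W \<subseteq> {j, k}" by blast
  obtain u w u' w' where cols: "columns ! j = (u, w)" "columns ! k = (u', w')"
    by (metis prod.exhaust)
  have X: "(u, w) \<in> X" "(u', w') \<in> X" "(u, w) \<noteq> (u', w')"
    using nth_columns[of j] nth_columns[of k] nth_eq_iff_index_eq[OF columns(2), of j k] cols jk(1-3)
    by (simp_all add: columns(3))
  have wd: "length u = m" "length w = m" "length u' = m" "length w' = m"
    using X X_words by (auto simp: words_length)
  have off: "f ! i = 0" "e ! i = 0" if "i < card X" "i \<noteq> j" "i \<noteq> k" for i
    using that jk(4) by (auto simp: W_def)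
  have syndrome: "(f ! j * shift_coord l (u, w) + f ! k * shift_coord l (u', w')) mod 3
      = (e ! j * phase_coord l (u, w) + e ! k * phase_coord l (u', w')) mod 3"
    if "l \<in> words 3 m \<times> words 3 m" for l
  proof -
    have "dot f (map (\<lambda>x. shift_coord l x mod 3) columns) mod 3
        = dot (map (\<lambda>x. phase_coord l x mod 3) columns) e mod 3"
      using neg that unfolding stabilizer_def by fastforce
    hence "dot f (map (shift_coord l) columns) mod 3 = dot (map (phase_coord l) columns) e mod 3"
      using ef(1,2) by (simp add: dot_map_mod_right dot_map_mod_left columns words_length)
    also have "dot (map (phase_coord l) columns) e = dot e (map (phase_coord l) columns)"
      using ef(1) by (intro dot_commute) (simp add: columns words_length)
    finally show ?thesis
      using dot_map_two_columns[of f columns j k "shift_coord l"]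
        dot_map_two_columns[of e columns j k "phase_coord l"] jk(1-3) ef(1,2) cols off
      by (simp add: columns words_length)
  qed
  have "f ! j = 0 \<and> f ! k = 0 \<and> e ! j = 0 \<and> e ! k = 0"
  proof (rule indep[OF X])
    fix r assume r: "r < m"
    define l where "l = (replicate m (0::nat))[r := 1]"
    have l: "l \<in> words 3 m" unfolding l_def by (rule unit_in_words) simp
    have dl: "dot l v = v ! r" if "length v = m" for v
      using dot_unit[OF that r] dot_commute[of l v] that by (simp add: l_def)
    \<comment> \<open>The coordinate functional yields the real part of the relation;
      \<open>i\<close> times it, used next, yields the negative of the imaginary part.\<close>
    have "(f ! j * u ! r + f ! k * u' ! r) mod 3 = (e ! j * w ! r + e ! k * w' ! r) mod 3"
      using syndrome[of "(l, replicate m 0)"] l wd by (simp add: shift_coord_def phase_coord_def dl)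
    thus "3 dvd f ! j * u ! r + f ! k * u' ! r + 2 * (e ! j * w ! r + e ! k * w' ! r)"
      by presburger
    have "(f ! j * (2 * w ! r) + f ! k * (2 * w' ! r)) mod 3 = (e ! j * u ! r + e ! k * u' ! r) mod 3"
      using syndrome[of "(replicate m 0, l)"] l wd by (simp add: shift_coord_def phase_coord_def dl)
    hence "(2 * (f ! j * w ! r + f ! k * w' ! r)) mod 3 = (e ! j * u ! r + e ! k * u' ! r) mod 3"
      by (simp add: algebra_simps)
    thus "3 dvd f ! j * w ! r + f ! k * w' ! r + (e ! j * u ! r + e ! k * u' ! r)"
      by presburger
  qed (use ef jk in \<open>auto simp: in_words_iff\<close>)
  hence "W = {}" using jk(4) by (auto simp: W_def)
  thus False using cW by auto
qed

text \<open>The premises \<open>rel\<close> say \<open>u1 + u2 = u3\<close> and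
  \<open>u1 + u4 = u5\<close> modulo 3. The coefficients 1, 1, 2 on the first triple form a phase
  error \<open>z\<close> of weight three orthogonal to all shifts, those on the second a word
  \<open>y\<close> orthogonal to all phases. The triples share only \<open>u1\<close>, hence
  \<open>dot z y = 1\<close>.\<close>

theorem code_of_point_set:
  assumes K: "card X = K + 2 * m" "1 \<le> K"
    and X: "(u1, replicate m 0) \<in> X" "(u2, replicate m 0) \<in> X" "(u3, replicate m 0) \<in> X"
      "(u4, replicate m 0) \<in> X" "(u5, replicate m 0) \<in> X"
    and dist: "distinct [u1, u2, u3, u4, u5]"
    and rel: "\<And>l. l \<in> words 3 m \<Longrightarrow> 3 dvd dot l u1 + dot l u2 + 2 * dot l u3"
      "\<And>l. l \<in> words 3 m \<Longrightarrow> 3 dvd dot l u1 + dot l u4 + 2 * dot l u5"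
  shows "\<exists>Q. quantum_code 3 (card X) K 3 Q \<and> pure_code 3 (card X) 3 Q"
proof -
  define h :: "nat list \<Rightarrow> nat list \<Rightarrow> nat list \<Rightarrow> nat list \<times> nat list \<Rightarrow> nat" where
    "h a b c x = (if x = (a, replicate m 0) \<or> x = (b, replicate m 0) then 1
      else if x = (c, replicate m 0) then 2 else 0)" for a b c x
  have dot_h: "dot (map (h a b c) columns) (map g columns)
      = g (a, replicate m 0) + g (b, replicate m 0) + 2 * g (c, replicate m 0)"
    if "distinct [a, b, c]" "(a, replicate m 0) \<in> X" "(b, replicate m 0) \<in> X" "(c, replicate m 0) \<in> X"
    for a b c g
  proof -
    have "dot (map (h a b c) columns) (map g columns) = (\<Sum>x\<in>X. h a b c x * g x)"
      by (simp add: dot_map_map columns)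
    also have "\<dots> = (\<Sum>x\<in>(\<lambda>v. (v, replicate m 0)) ` {a, b, c}. h a b c x * g x)"
      using that finite_X by (intro sum.mono_neutral_right) (auto simp: h_def)
    also have "\<dots> = g (a, replicate m 0) + g (b, replicate m 0) + 2 * g (c, replicate m 0)"
      using that(1) by (auto simp: h_def)
    finally show ?thesis .
  qed
  define z where "z = map (h u1 u2 u3) columns"
  define y where "y = map (h u1 u4 u5) columns"
  have dz: "distinct [u1, u2, u3]" and dy: "distinct [u1, u4, u5]" using dist by auto
  have len: "length v = m" if "(v, replicate m 0) \<in> X" for v
    using that X_words by (auto simp: words_length)
  have "card {(u1, replicate m (0::nat)), (u2, replicate m 0)} \<le> card X"
    using X by (intro card_mono finite_X) auto
  hence card: "2 \<le> card X" using dist by simp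
  show ?thesis
  proof (rule stabilizer_code[of K z y])
    have "card stabilizer * 3 ^ K \<le> 3 ^ (2 * m) * 3 ^ K"
      using card_stabilizer by simp
    thus "card stabilizer * 3 ^ K \<le> 3 ^ card X" by (simp add: K(1) power_add mult.commute)
    have "(3::nat) ^ 1 \<le> 3 ^ K" using K(2) by (intro power_increasing) auto
    thus "2 \<le> (3::nat) ^ K" by simp
    show "z \<in> words 3 (card X)" "y \<in> words 3 (card X)"
      by (auto simp: in_words_iff z_def y_def columns h_def)
    show "3 dvd dot z a" if ab: "(a, b) \<in> stabilizer" for a b
    proof -
      obtain l where l: "l \<in> words 3 m \<times> words 3 m" "a = map (\<lambda>x. shift_coord l x mod 3) columns"
        using ab unfolding stabilizer_def by blast
      have "dot z a mod 3 = dot z (map (shift_coord l) columns) mod 3"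
        unfolding l(2) z_def by (simp add: dot_map_mod_right)
      also have "\<dots> = 0"
        using rel(1)[of "fst l"] l(1) X unfolding z_def dot_h[OF dz X(1-3)]
        by (auto simp: shift_coord_def words_length add.assoc)
      finally show ?thesis by (simp add: dvd_eq_mod_eq_0)
    qed
    show "3 dvd dot b y" if ab: "(a, b) \<in> stabilizer" for a b
    proof -
      obtain l where l: "l \<in> words 3 m \<times> words 3 m" "b = map (\<lambda>x. phase_coord l x mod 3) columns"
        using ab unfolding stabilizer_def by blast
      have "dot b y = dot y b" by (intro dot_commute) (simp add: l y_def)
      also have "dot y b mod 3 = dot y (map (phase_coord l) columns) mod 3"
        unfolding l(2) y_def by (simp add: dot_map_mod_right)
      also have "\<dots> = 0"
        using rel(2)[of "snd l"] l(1) X unfolding y_def dot_h[OF dy X(1,4,5)]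
        by (auto simp: phase_coord_def words_length add.assoc)
      finally show ?thesis by (simp add: dvd_eq_mod_eq_0)
    qed
    have "dot z y = 1"
      unfolding y_def z_def dot_h[OF dz X(1-3)] using dist by (auto simp: h_def)
    thus "\<not> 3 dvd dot z y" by simp
    have "qweight (replicate (card X) 0) z = length (filter (\<lambda>x. h u1 u2 u3 x \<noteq> 0) columns)"
      unfolding qweight_def z_def length_filter_conv_card
      by (intro arg_cong[where f = card] Collect_cong) (auto simp: columns)
    also have "\<dots> = card {x \<in> X. h u1 u2 u3 x \<noteq> 0}"
      using distinct_card[of "filter (\<lambda>x. h u1 u2 u3 x \<noteq> 0) columns"] columns by simp
    also have "{x \<in> X. h u1 u2 u3 x \<noteq> 0} = {(u1, replicate m 0), (u2, replicate m 0), (u3, replicate m 0)}"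
      using X by (auto simp: h_def)
    finally show "qweight (replicate (card X) 0) z = 3" using dz by simp
  qed (rule detects_weight_le_2[OF _ _ _ _ card])
qed

end

section \<open>Moments of words, projective points and affine subspaces over F_3\<close>

lemma words_0 [simp]: "words p 0 = {[]}"
  by (auto simp: words_def)

lemma Cons_in_words [simp]: "x # v \<in> words p (Suc k) \<longleftrightarrow> x < p \<and> v \<in> words p k"
  by (auto simp: words_def)

lemma in_words_SucE:
  assumes "v \<in> words p (Suc k)"
  obtains x v' where "v = x # v'" "x < p" "v' \<in> words p k"
  using assms by (cases v) (auto simp: words_def)

lemma append_in_words: "x \<in> words p k \<Longrightarrow> y \<in> words p l \<Longrightarrow> x @ y \<in> words p (k + l)"
  by (auto simp: words_def)

lemma sum_words_Suc:
  "(\<Sum>v\<in>words p (Suc k). f v) = (\<Sum>x<p. \<Sum>v\<in>words p k. f (x # v))"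
proof -
  have "bij_betw (\<lambda>(x, v). x # v) ({..<p} \<times> words p k) (words p (Suc k))"
    by (auto simp: bij_betw_def inj_on_def image_iff elim!: in_words_SucE)
  from sum.reindex_bij_betw[OF this, of f, symmetric] show ?thesis
    by (simp add: sum.cartesian_product case_prod_unfold)
qed

lemma sum_words_2: "(\<Sum>v\<in>words p 2. f v) = (\<Sum>x<p. \<Sum>y<p. f [x, y])"
  unfolding numeral_2_eq_2 by (simp add: sum_words_Suc)

lemma sum_lessThan_3: "(\<Sum>x<3. f x) = f 0 + f 1 + (f 2 :: nat)" for f :: "nat \<Rightarrow> nat"
  by (simp add: numeral_3_eq_3 numeral_2_eq_2)

lemma dot_Nil [simp]: "dot [] y = 0"
  by (simp add: dot_def)

lemma dot_Cons [simp]: "dot (a # l) (x # v) = a * x + dot l v"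
  by (simp add: dot_def sum.lessThan_Suc_shift del: sum.lessThan_Suc)

lemma dot_append: "length l = length v \<Longrightarrow> dot (l @ l') (v @ v') = dot l v + dot l' v'"
  by (induction l v rule: list_induct2) auto

text \<open>Polynomials of degree at most two sum to zero over F_3-spaces of dimension at least two;
  in dimension one the squares sum to 5. The constants are general because the induction absorbs the
  first coordinate into them.\<close>

lemma affine_moment:
  assumes "2 \<le> k" "length l = k" "length l' = k"
  shows "3 dvd (\<Sum>v\<in>words 3 k. (c + dot l v) * (c' + dot l' v))"
  using assms
proof (induction k arbitrary: l l' c c' rule: dec_induct)
  case base
  then obtain a b a' b' where l: "l = [a, b]" "l' = [a', b']"
    by (auto simp: numeral_2_eq_2 length_Suc_conv)
  show ?case
    \<comment> \<open>The witness is the expanded sum over nine words divided by 3; its coefficient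
      5 is \<open>0 + 1 + 4\<close>.\<close>
    by (rule dvdI[of _ _ "3 * c * c' + 3 * c * (a' + b') + 3 * c' * (a + b) + 5 * (a * a' + b * b')
        + 3 * (a * b' + b * a')"])
      (simp add: l sum_words_2 sum_lessThan_3 algebra_simps)
next
  case (step k)
  then obtain a l1 a' l1' where l: "l = a # l1" "l' = a' # l1'" "length l1 = k" "length l1' = k"
    by (auto simp: length_Suc_conv)
  have "3 dvd (\<Sum>v\<in>words 3 k. (c + a * x + dot l1 v) * (c' + a' * x + dot l1' v))" for x
    by (rule step.IH) (use l in auto)
  thus ?case unfolding sum_words_Suc by - (rule dvd_sum, simp add: l add.assoc)
qed

text \<open>Normalised representatives of the points over \<open>F\<^sub>3\<close>: the first nonzero coordinate is \<open>1\<close>.\<close>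

primrec proj_points :: "nat \<Rightarrow> nat list set" where
  "proj_points 0 = {}"
| "proj_points (Suc m) = Cons 0 ` proj_points m \<union> Cons 1 ` words 3 m"

lemma proj_points_words: "proj_points m \<subseteq> words 3 m"
  by (induction m) auto

lemma finite_proj_points [simp]: "finite (proj_points m)"
  by (induction m) auto

lemma sum_proj_points_Suc:
  "(\<Sum>v\<in>proj_points (Suc m). f v) = (\<Sum>v\<in>proj_points m. f (0 # v)) + (\<Sum>v\<in>words 3 m. f (1 # v))"
  by (simp, subst sum.union_disjoint) (auto simp: sum.reindex inj_on_def)

lemma sum_proj_points_2: "(\<Sum>v\<in>proj_points 2. f v) = f [0, 1] + (\<Sum>x<3. f [1, x])"
  unfolding numeral_2_eq_2 by (simp add: sum_proj_points_Suc sum_words_Suc del: proj_points.simps(2))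

lemma card_proj_points: "2 * card (proj_points m) + 1 = 3 ^ m"
proof (induction m)
  case (Suc m)
  have "card (proj_points (Suc m)) = card (proj_points m) + 3 ^ m"
    by (simp, subst card_Un_disjoint) (auto simp: card_image inj_on_def card_words)
  thus ?case using Suc by simp
qed simp

text \<open>Projective points split into those of a smaller space, where induction applies, and the
  affine chart with first coordinate 1, where \<open>affine_moment\<close> applies with the leading
  coefficients as constants.\<close>

lemma proj_points_moment:
  assumes "2 \<le> m" "length l = m" "length l' = m"
  shows "3 dvd (\<Sum>v\<in>proj_points m. dot l v * dot l' v)"
  using assms
proof (induction m arbitrary: l l' rule: dec_induct)
  case base
  then obtain a b a' b' where l: "l = [a, b]" "l' = [a', b']"
    by (auto simp: numeral_2_eq_2 length_Suc_conv)
  show ?case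
    by (rule dvdI[of _ _ "a * a' + a * b' + b * a' + 2 * b * b'"])
      (simp add: l sum_proj_points_2 sum_lessThan_3 algebra_simps)
next
  case (step m)
  then obtain a l1 a' l1' where l: "l = a # l1" "l' = a' # l1'" "length l1 = m" "length l1' = m"
    by (auto simp: length_Suc_conv)
  show ?case unfolding sum_proj_points_Suc
    using step.IH[OF l(3,4)] affine_moment[OF step.hyps(1) l(3,4), of a a']
    by (simp add: l)
qed

lemma proj_points_nonzero: "u \<in> proj_points m \<Longrightarrow> \<exists>r<m. u ! r = 1"
proof (induction m arbitrary: u)
  case (Suc m)
  show ?case
  proof (cases "u \<in> Cons 0 ` proj_points m")
    case True
    then obtain v where "u = 0 # v" "v \<in> proj_points m" by auto
    thus ?thesis using Suc.IH[of v] by (metis Suc_less_eq nth_Cons_Suc)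
  next
    case False
    thus ?thesis using Suc.prems by (intro exI[of _ 0]) auto
  qed
qed simp

text \<open>The linear system has determinant \<open>x' - x\<close>, which is nonzero modulo
  3.\<close>

lemma vandermonde_mod_3:
  fixes f f' x x' :: nat
  assumes "f < 3" "f' < 3" "x < 3" "x' < 3" "x \<noteq> x'" "3 dvd f + f'" "3 dvd f * x + f' * x'"
  shows "f = 0 \<and> f' = 0"
proof -
  have "f + f' = 0 \<or> f + f' = 3" using assms(1,2,6) by presburger
  thus ?thesis
  proof
    assume "f + f' = 3"
    hence "f = 1 \<and> f' = 2 \<or> f = 2 \<and> f' = 1" using assms(1,2) by linarith
    thus ?thesis
    proof
      assume "f = 1 \<and> f' = 2"
      hence "3 dvd x + 2 * x'" using assms(7) by simp
      thus ?thesis using assms(3-5) by presburger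
    next
      assume "f = 2 \<and> f' = 1"
      hence "3 dvd 2 * x + x'" using assms(7) by simp
      thus ?thesis using assms(3-5) by presburger
    qed
  qed simp
qed

text \<open>With both leading coordinates 0, induction compares the tails. With exactly one equal to
  1, its coefficient vanishes at once and an entry 1 of the other point kills the other coefficient.
  With both equal to 1, a coordinate where the points differ gives a Vandermonde system.\<close>

lemma proj_points_independent:
  assumes "u \<in> proj_points m" "u' \<in> proj_points m" "u \<noteq> u'" "f < 3" "f' < 3"
    and "\<And>r. r < m \<Longrightarrow> 3 dvd f * u ! r + f' * u' ! r"
  shows "f = 0 \<and> f' = 0"
  using assms
proof (induction m arbitrary: u u')
  case (Suc m)
  have tl: "3 dvd f * v ! r + f' * v' ! r" if "u = x # v" "u' = x' # v'" "r < m" for x x' v v' r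
    using Suc.prems(6)[of "Suc r"] that by simp
  have hd: "3 dvd f * x + f' * x'" if "u = x # v" "u' = x' # v'" for x x' v v'
    using Suc.prems(6)[of 0] that by simp
  have small: "x = 0" if "3 dvd x" "x < 3" for x :: nat
    using that by auto
  consider v v' where "u = 0 # v" "u' = 0 # v'" "v \<in> proj_points m" "v' \<in> proj_points m"
    | v v' where "u = 0 # v" "u' = 1 # v'" "v \<in> proj_points m"
    | v v' where "u = 1 # v" "u' = 0 # v'" "v' \<in> proj_points m"
    | v v' where "u = 1 # v" "u' = 1 # v'" "v \<in> words 3 m" "v' \<in> words 3 m"
    using Suc.prems(1,2) by auto
  thus ?case
  proof cases
    case (1 v v')
    show ?thesis
      using Suc.prems(3) by (intro Suc.IH[OF 1(3,4) _ Suc.prems(4,5)] tl[OF 1(1,2)]) (simp_all add: 1)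
  next
    case (2 v v')
    have f': "f' = 0" using hd[OF 2(1,2)] Suc.prems(5) small by simp
    obtain r where r: "r < m" "v ! r = 1" using proj_points_nonzero[OF 2(3)] by blast
    show ?thesis using tl[OF 2(1,2) r(1)] r(2) f' small[OF _ Suc.prems(4)] by simp
  next
    case (3 v v')
    have f: "f = 0" using hd[OF 3(1,2)] Suc.prems(4) small by simp
    obtain r where r: "r < m" "v' ! r = 1" using proj_points_nonzero[OF 3(3)] by blast
    show ?thesis using tl[OF 3(1,2) r(1)] r(2) f small[OF _ Suc.prems(5)] by simp
  next
    case (4 v v')
    have "v \<noteq> v'" using 4 Suc.prems(3) by simp
    then obtain r where r: "r < m" "v ! r \<noteq> v' ! r"
      using 4(3,4) by (metis in_words_iff nth_equalityI)
    show ?thesis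
      using hd[OF 4(1,2)] tl[OF 4(1,2) r(1)] r 4(3,4) Suc.prems(4,5)
      by (intro vandermonde_mod_3[of f f' "v ! r" "v' ! r"]) (auto simp: in_words_iff)
  qed
qed simp

definition affine_points :: "nat \<Rightarrow> nat \<Rightarrow> nat list set" where
  "affine_points s t = (\<lambda>v. 1 # replicate s 0 @ v) ` words 3 t"

lemma inj_affine: "inj_on (\<lambda>v. 1 # replicate s (0::nat) @ v) A"
  by (simp add: inj_on_def)

lemma affine_points_subset: "affine_points s t \<subseteq> proj_points (Suc (s + t))"
  by (auto simp: affine_points_def intro!: append_in_words)

lemma card_affine_points: "card (affine_points s t) = 3 ^ t"
  unfolding affine_points_def by (subst card_image[OF inj_affine]) (rule card_words)

text \<open>The constants will carry the effect of translating the points by an imaginary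
  vector.\<close>

lemma affine_points_moment:
  assumes "2 \<le> t" "length l = Suc (s + t)" "length l' = Suc (s + t)"
  shows "3 dvd (\<Sum>u\<in>affine_points s t. (c + dot l u) * (c' + dot l' u))"
proof -
  have *: "dot l (1 # replicate s 0 @ v) = hd l + dot (drop (Suc s) l) v" if "length l = Suc (s + t)" for l v
  proof -
    obtain a k where l: "l = a # k" "length k = s + t" using \<open>length l = _\<close> by (auto simp: length_Suc_conv)
    have "dot (take s k @ drop s k) (replicate s 0 @ v) = dot (drop s k) v"
      using l by (subst dot_append) auto
    thus ?thesis using l by simp
  qed
  have "(\<Sum>u\<in>affine_points s t. (c + dot l u) * (c' + dot l' u))
     = (\<Sum>v\<in>words 3 t. (c + hd l + dot (drop (Suc s) l) v) * (c' + hd l' + dot (drop (Suc s) l') v))"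
    unfolding affine_points_def
    by (subst sum.reindex[OF inj_affine]) (simp add: *[OF assms(2)] *[OF assms(3)] add.assoc del: One_nat_def)
  thus ?thesis using affine_moment[OF assms(1)] assms(2,3) by simp
qed

section \<open>The point sets: real, enlarged by a translate, and reduced\<close>

definition real_points :: "nat \<Rightarrow> nat list set \<Rightarrow> (nat list \<times> nat list) set" where
  "real_points m U = (\<lambda>u. (u, replicate m 0)) ` U"

lemma card_real_points: "card (real_points m U) = card U"
  unfolding real_points_def by (intro card_image) (simp add: inj_on_def)

lemma sum_real_points:
  assumes "l \<in> words 3 m \<times> words 3 m" "l' \<in> words 3 m \<times> words 3 m"
  shows "(\<Sum>x\<in>real_points m U. shift_coord l x * phase_coord l' x) = (\<Sum>u\<in>U. dot (fst l) u * dot (snd l') u)"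
  using assms unfolding real_points_def
  by (subst sum.reindex) (auto simp: inj_on_def shift_coord_def phase_coord_def words_length intro!: sum.cong)

text \<open>For real points the independence condition separates into one F_3-relation for
  \<open>f\<close>, \<open>f'\<close> and one for \<open>e\<close>, \<open>e'\<close>.\<close>

lemma orthogonal_real_points:
  assumes U: "U \<subseteq> proj_points m"
    and mom: "\<And>l l'. length l = m \<Longrightarrow> length l' = m \<Longrightarrow> 3 dvd (\<Sum>u\<in>U. dot l u * dot l' u)"
  shows "orthogonal_point_set m (real_points m U)"
proof
  show "real_points m U \<subseteq> words 3 m \<times> words 3 m"
    using U proj_points_words by (auto simp: real_points_def)
  show "3 dvd (\<Sum>x\<in>real_points m U. shift_coord l x * phase_coord l' x)"
    if "l \<in> words 3 m \<times> words 3 m" "l' \<in> words 3 m \<times> words 3 m" for l l'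
    unfolding sum_real_points[OF that] using that by (intro mom) (auto simp: words_length)
next
  fix u w u' w' :: "nat list" and f e f' e' :: nat
  assume X: "(u, w) \<in> real_points m U" "(u', w') \<in> real_points m U" "(u, w) \<noteq> (u', w')"
    and lt: "f < 3" "e < 3" "f' < 3" "e' < 3"
    and re: "\<And>r. r < m \<Longrightarrow> 3 dvd f * u ! r + f' * u' ! r + 2 * (e * w ! r + e' * w' ! r)"
    and im: "\<And>r. r < m \<Longrightarrow> 3 dvd f * w ! r + f' * w' ! r + (e * u ! r + e' * u' ! r)"
  have u: "u \<in> proj_points m" "u' \<in> proj_points m" "u \<noteq> u'" and w: "w = replicate m 0" "w' = replicate m 0"
    using X U by (auto simp: real_points_def)
  show "f = 0 \<and> f' = 0 \<and> e = 0 \<and> e' = 0"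
    using proj_points_independent[OF u lt(1,3)] proj_points_independent[OF u lt(2,4)] re im w by simp
qed

text \<open>The affine points are translated by \<open>i\<close> times the second unit vector. The
  argument \<open>Suc s\<close> reserves a zero there, so a translated point begins with the
  coordinates 1 and \<open>i\<close>.\<close>

definition mixed_points :: "nat \<Rightarrow> nat \<Rightarrow> (nat list \<times> nat list) set" where
  "mixed_points s t = real_points (Suc (Suc s + t)) (proj_points (Suc (Suc s + t)))
     \<union> (\<lambda>u. (u, 0 # 1 # replicate (s + t) 0)) ` affine_points (Suc s) t"

lemma card_mixed_points:
  "card (mixed_points s t) = card (proj_points (Suc (Suc s + t))) + 3 ^ t"
proof -
  have "card ((\<lambda>u. (u, 0 # 1 # replicate (s + t) 0 :: nat list)) ` affine_points (Suc s) t) = 3 ^ t"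
    by (subst card_image) (auto simp: inj_on_def card_affine_points)
  thus ?thesis unfolding mixed_points_def
    by (subst card_Un_disjoint)
      (auto simp: card_real_points, auto simp: real_points_def affine_points_def)
qed

text \<open>The hypotheses say \<open>(f + i e) (a, b) + (f' + i e') (1, i) = 0\<close> in \<open>F\<^sub>9\<^sup>2\<close>; they force \<open>f (a\<^sup>2 + b\<^sup>2) = e (a\<^sup>2 + b\<^sup>2) = 0\<close>
  in \<open>F\<^sub>3\<close>, where a sum of two squares vanishes only trivially.\<close>

lemma no_square_root_of_minus_one:
  fixes f e f' e' a b :: nat
  assumes lt: "f < 3" "e < 3" "f' < 3" "e' < 3" "a < 3" "b < 3"
    and dvd: "3 dvd f * a + f'" "3 dvd e * a + e'" "3 dvd f * b + 2 * e'" "3 dvd f' + e * b"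
  shows "f' = 0 \<and> e' = 0 \<and> (f = 0 \<and> e = 0 \<or> a = 0 \<and> b = 0)"
proof (cases "a = 0 \<and> b = 0")
  case True
  thus ?thesis using dvd(1,2) lt(3,4) by auto
next
  case False
  have "f * (a * a + b * b) + (a * (f' + e * b) + 3 * (b * e'))
      = a * (f * a + f') + b * (e * a + e') + b * (f * b + 2 * e')"
    by (simp add: algebra_simps)
  moreover have "3 dvd \<dots>" "3 dvd a * (f' + e * b) + 3 * (b * e')"
    using dvd by (auto intro!: dvd_add dvd_mult)
  ultimately have 1: "3 dvd f * (a * a + b * b)" by (metis dvd_add_left_iff)
  have "e * (a * a + b * b) + (b * (f * a + f') + 3 * (a * e'))
      = a * (e * a + e') + a * (f * b + 2 * e') + b * (f' + e * b)"
    by (simp add: algebra_simps)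
  moreover have "3 dvd \<dots>" "3 dvd b * (f * a + f') + 3 * (a * e')"
    using dvd by (auto intro!: dvd_add dvd_mult)
  ultimately have 2: "3 dvd e * (a * a + b * b)" by (metis dvd_add_left_iff)
  have "a = 0 \<or> a = 1 \<or> a = 2" "b = 0 \<or> b = 1 \<or> b = 2" using lt(5,6) by linarith+
  hence "a * a + b * b \<in> {1, 2, 4, 5, 8}" using False by auto
  hence "f = 0" "e = 0" using 1 2 lt(1,2) by (auto; presburger)+
  thus ?thesis using dvd(1,2) lt(3,4) by auto
qed

lemma nth_second_unit: "r < Suc (Suc k) \<Longrightarrow> (0 # 1 # replicate k 0 :: nat list) ! r = (if r = 1 then 1 else 0)"
  by (auto simp: nth_Cons split: nat.split)

lemma nth_affine_points:
  assumes "u \<in> affine_points (Suc s) t"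
  shows "u ! 0 = 1" "u ! 1 = 0"
  using assms by (auto simp: affine_points_def)

text \<open>The first two coordinates kill \<open>f'\<close> and \<open>e'\<close> by
  \<open>no_square_root_of_minus_one\<close>; an entry 1 of \<open>u\<close> then kills
  \<open>f\<close> and \<open>e\<close>.\<close>

lemma mixed_independent:
  fixes f e f' e' :: nat
  assumes u: "u \<in> proj_points (Suc (Suc s + t))" and u': "u' \<in> affine_points (Suc s) t"
    and lt: "f < 3" "e < 3" "f' < 3" "e' < 3"
    and re: "\<And>r. r < Suc (Suc s + t) \<Longrightarrow> 3 dvd f * u ! r + f' * u' ! r
      + 2 * (e' * (0 # 1 # replicate (s + t) 0) ! r)"
    and im: "\<And>r. r < Suc (Suc s + t) \<Longrightarrow> 3 dvd f' * (0 # 1 # replicate (s + t) 0) ! r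
      + (e * u ! r + e' * u' ! r)"
  shows "f = 0 \<and> f' = 0 \<and> e = 0 \<and> e' = 0"
proof -
  have len: "0 < Suc (Suc s + t)" "1 < Suc (Suc s + t)" by auto
  have "u ! 0 < 3" "u ! 1 < 3"
    using u proj_points_words len by (auto simp: in_words_iff subset_iff)
  moreover note r0 = re[OF len(1)] im[OF len(1)] and r1 = re[OF len(2)] im[OF len(2)]
  ultimately have *: "f' = 0 \<and> e' = 0 \<and> (f = 0 \<and> e = 0 \<or> u ! 0 = 0 \<and> u ! 1 = 0)"
    using nth_affine_points[OF u'] lt
    by (intro no_square_root_of_minus_one) simp_all
  obtain r where r: "r < Suc (Suc s + t)" "u ! r = 1"
    using proj_points_nonzero[OF u] by blast
  have "3 dvd f" "3 dvd e" using re[OF r(1)] im[OF r(1)] r(2) * by simp_all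
  thus ?thesis using * lt(1,2) by auto
qed

lemma orthogonal_mixed_points:
  assumes t: "2 \<le> t"
  shows "orthogonal_point_set (Suc (Suc s + t)) (mixed_points s t)"
proof
  let ?m = "Suc (Suc s + t)" and ?q = "0 # 1 # replicate (s + t) 0 :: nat list"
  let ?A = "affine_points (Suc s) t" and ?P = "proj_points ?m"
  have AP: "?A \<subseteq> ?P" using affine_points_subset[of "Suc s" t] by simp
  have q: "?q \<in> words 3 ?m" by simp
  have z: "replicate ?m 0 \<in> words 3 ?m" by (rule zero_in_words) simp
  show "mixed_points s t \<subseteq> words 3 ?m \<times> words 3 ?m"
    using AP proj_points_words[of ?m] q z
    unfolding mixed_points_def real_points_def by blast
  show "3 dvd (\<Sum>x\<in>mixed_points s t. shift_coord l x * phase_coord l' x)"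
    if l: "l \<in> words 3 ?m \<times> words 3 ?m" "l' \<in> words 3 ?m \<times> words 3 ?m" for l l'
  proof -
    have len: "length (fst l) = ?m" "length (snd l') = ?m" using l by (auto simp: words_length)
    \<comment> \<open>The translation contributes only constants, which is the shape of
      \<open>affine_points_moment\<close>.\<close>
    have "(\<Sum>x\<in>(\<lambda>u. (u, ?q)) ` ?A. shift_coord l x * phase_coord l' x)
        = (\<Sum>u\<in>?A. (2 * dot (snd l) ?q + dot (fst l) u) * (dot (fst l') ?q + dot (snd l') u))"
      by (subst sum.reindex) (auto simp: inj_on_def shift_coord_def phase_coord_def algebra_simps)
    hence "3 dvd (\<Sum>x\<in>(\<lambda>u. (u, ?q)) ` ?A. shift_coord l x * phase_coord l' x)"
      using affine_points_moment[OF t, of "fst l" "Suc s" "snd l'"] len by simp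
    moreover have "3 dvd (\<Sum>x\<in>real_points ?m ?P. shift_coord l x * phase_coord l' x)"
      unfolding sum_real_points[OF l] using t by (intro proj_points_moment len) simp
    moreover have "real_points ?m ?P \<inter> (\<lambda>u. (u, ?q)) ` ?A = {}"
      by (auto simp: real_points_def)
    ultimately show ?thesis unfolding mixed_points_def
      by (subst sum.union_disjoint) (auto simp: real_points_def affine_points_def intro: dvd_add)
  qed
next
  let ?m = "Suc (Suc s + t)" and ?q = "0 # 1 # replicate (s + t) 0 :: nat list"
  let ?A = "affine_points (Suc s) t" and ?P = "proj_points ?m"
  have AP: "?A \<subseteq> ?P" using affine_points_subset[of "Suc s" t] by simp
  fix u w u' w' :: "nat list" and f e f' e' :: nat
  assume X: "(u, w) \<in> mixed_points s t" "(u', w') \<in> mixed_points s t" "(u, w) \<noteq> (u', w')"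
    and lt: "f < 3" "e < 3" "f' < 3" "e' < 3"
    and re: "\<And>r. r < ?m \<Longrightarrow> 3 dvd f * u ! r + f' * u' ! r + 2 * (e * w ! r + e' * w' ! r)"
    and im: "\<And>r. r < ?m \<Longrightarrow> 3 dvd f * w ! r + f' * w' ! r + (e * u ! r + e' * u' ! r)"
  consider "u \<in> ?P" "w = replicate ?m 0" "u' \<in> ?P" "w' = replicate ?m 0"
    | "u \<in> ?P" "w = replicate ?m 0" "u' \<in> ?A" "w' = ?q"
    | "u \<in> ?A" "w = ?q" "u' \<in> ?P" "w' = replicate ?m 0"
    | "u \<in> ?A" "w = ?q" "u' \<in> ?A" "w' = ?q"
    using X(1,2) unfolding mixed_points_def real_points_def by blast
  thus "f = 0 \<and> f' = 0 \<and> e = 0 \<and> e' = 0"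
  proof cases
    case 1
    hence "u \<noteq> u'" using X(3) by simp
    moreover have "3 dvd f * u ! r + f' * u' ! r" "3 dvd e * u ! r + e' * u' ! r" if "r < ?m" for r
      using re[OF that] im[OF that] that unfolding 1(2,4) by (simp_all del: replicate_Suc)
    ultimately show ?thesis
      using proj_points_independent[OF 1(1,3), of f f'] proj_points_independent[OF 1(1,3), of e e'] lt
      by blast
  next
    case 2
    show ?thesis
    proof (rule mixed_independent[OF 2(1,3) lt])
      fix r assume r: "r < ?m"
      show "3 dvd f * u ! r + f' * u' ! r + 2 * (e' * ?q ! r)" "3 dvd f' * ?q ! r + (e * u ! r + e' * u' ! r)"
        using re[OF r] im[OF r] r unfolding 2(2,4) by (simp_all del: replicate_Suc)
    qed
  next
    case 3
    have "f' = 0 \<and> f = 0 \<and> e' = 0 \<and> e = 0"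
    proof (rule mixed_independent[OF 3(3,1) lt(3,4,1,2)])
      fix r assume r: "r < ?m"
      show "3 dvd f' * u' ! r + f * u ! r + 2 * (e * ?q ! r)" "3 dvd f * ?q ! r + (e' * u' ! r + e * u ! r)"
        using re[OF r] im[OF r] r unfolding 3(2,4) by (simp_all del: replicate_Suc add: ac_simps)
    qed
    thus ?thesis by blast
  next
    \<comment> \<open>Both points have first coordinate 1 and differ at a coordinate other than the
      translated one, where both are real. This gives one Vandermonde system for \<open>f\<close>,
      \<open>f'\<close> and one for \<open>e\<close>, \<open>e'\<close>.\<close>
    case 4
    have uw: "u \<in> words 3 ?m" "u' \<in> words 3 ?m" using 4(1,3) AP proj_points_words by blast+
    have "u \<noteq> u'" using X(3) 4 by simp
    then obtain r where r: "r < ?m" "u ! r \<noteq> u' ! r"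
      using words_eqI[OF uw] by auto
    have "r \<noteq> 1" using r(2) nth_affine_points(2)[OF 4(1)] nth_affine_points(2)[OF 4(3)] by auto
    hence q: "?q ! r = 0" using nth_second_unit[of r "s + t"] r(1) by simp
    have b: "u ! r < 3" "u' ! r < 3" using uw r(1) by (auto simp: in_words_iff)
    have "0 < ?m" by simp
    from re[OF this] im[OF this] have "3 dvd f + f'" "3 dvd e + e'"
      using nth_affine_points(1)[OF 4(1)] nth_affine_points(1)[OF 4(3)] unfolding 4(2,4) by simp_all
    moreover have "3 dvd f * u ! r + f' * u' ! r" "3 dvd e * u ! r + e' * u' ! r"
      using re[OF r(1)] im[OF r(1)] unfolding 4(2,4) q by simp_all
    ultimately show ?thesis
      using vandermonde_mod_3[OF lt(1,3) b r(2)] vandermonde_mod_3[OF lt(2,4) b r(2)] by blast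
  qed
qed

lemma orthogonal_proj_minus_affine:
  assumes "2 \<le> t"
  shows "orthogonal_point_set (Suc (s + t)) (real_points (Suc (s + t)) (proj_points (Suc (s + t)) - affine_points s t))"
proof (rule orthogonal_real_points)
  fix l l' :: "nat list" assume l: "length l = Suc (s + t)" "length l' = Suc (s + t)"
  have "(\<Sum>u\<in>proj_points (Suc (s + t)). dot l u * dot l' u)
      = (\<Sum>u\<in>proj_points (Suc (s + t)) - affine_points s t. dot l u * dot l' u)
        + (\<Sum>u\<in>affine_points s t. dot l u * dot l' u)"
    by (rule sum.subset_diff[OF affine_points_subset finite_proj_points])
  moreover have "3 dvd (\<Sum>u\<in>proj_points (Suc (s + t)). dot l u * dot l' u)"
    using assms by (intro proj_points_moment l) simp
  moreover have "3 dvd (\<Sum>u\<in>affine_points s t. dot l u * dot l' u)"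
    using affine_points_moment[OF assms l, of 0 0] by simp
  ultimately show "3 dvd (\<Sum>u\<in>proj_points (Suc (s + t)) - affine_points s t. dot l u * dot l' u)"
    by (simp add: dvd_add_left_iff)
qed auto

section \<open>Code sizes, the Hamming bound, and the three families of codes\<close>

lemma zeros_append_in_proj_points: "v \<in> proj_points m \<Longrightarrow> replicate i 0 @ v \<in> proj_points (i + m)"
  by (induction i) auto

lemma append_zeros_in_proj_points: "v \<in> proj_points m \<Longrightarrow> v @ replicate k 0 \<in> proj_points (m + k)"
  by (induction m arbitrary: v) (auto intro!: append_in_words)

text \<open>The factor 8 turns \<open>3 ^ m + 4 \<le> 4 * N\<close> into
  \<open>2 * m + 1 \<le> N\<close>, hence into a positive \<open>K\<close>.\<close>

lemma power_3_ge: "3 \<le> m \<Longrightarrow> 8 * m \<le> (3::nat) ^ m"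
  by (induction m rule: dec_induct) auto

text \<open>At distance 5 the bound involves balls of radius two, whose quadratic term
  \<open>64 * (N choose 2)\<close> alone exceeds \<open>3 ^ (2 * m)\<close>.\<close>

lemma hamming_bound_violated:
  assumes "3 ^ m + 4 \<le> 4 * N" "2 * m \<le> N"
  shows "QHB_at_least_almost_optimal 3 N (N - 2 * m) 3"
proof -
  have "2 dvd N * (N - 1)" by (cases N) auto
  hence "2 * (N choose 2) = N * (N - 1)" by (simp add: choose_two)
  \<comment> \<open>The size assumption bounds one factor by \<open>4 * N\<close> and the other by
    \<open>4 * (N - 1)\<close>.\<close>
  moreover have "(3 ^ m) * (3 ^ m) \<le> (4 * N) * (4 * (N - 1))"
    using assms(1) by (intro mult_mono) auto
  ultimately have "3 ^ (2 * m) \<le> 32 * (N choose 2)"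
    by (simp add: mult_2 power_add)
  moreover have "(\<Sum>j\<le>(3 + 2 - 1) div 2. (N choose j) * (3\<^sup>2 - 1) ^ j) = 1 + N * 8 + 64 * (N choose 2)"
  proof -
    have "{..(3 + 2 - 1) div 2} = {0, 1, 2 :: nat}" by auto
    thus ?thesis by simp
  qed
  ultimately show ?thesis
    using assms(2) by (simp add: QHB_at_least_almost_optimal_def quantum_hamming_bound_def)
qed

text \<open>The first real point lies on a line with the second and third and on another with the fourth and
  fifth: the phase error on one line is undetected, and its eigenvalue varies along the other.\<close>

lemma ternary_code_of_point_set:
  assumes X: "orthogonal_point_set m X" and m: "m = i + (3 + k)"
    and pts: "\<And>v. v \<in> proj_points 3 \<Longrightarrow> (replicate i 0 @ v @ replicate k 0, replicate m 0) \<in> X"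
    and size: "3 ^ m + 4 \<le> 4 * card X"
  shows "\<exists>Q. quantum_code 3 (card X) (card X - 2 * m) 3 Q \<and> pure_code 3 (card X) 3 Q \<and>
    QHB_at_least_almost_optimal 3 (card X) (card X - 2 * m) 3"
proof -
  interpret orthogonal_point_set m X by (rule X)
  have N: "2 * m + 1 \<le> card X" using power_3_ge[of m] size m by linarith
  define g where "g v = replicate i 0 @ v @ replicate k (0::nat)" for v
  have g: "(g v, replicate m 0) \<in> X" if "v \<in> proj_points 3" for v
    using pts[OF that] by (simp add: g_def)
  have dot_g: "dot l (g v) = dot (take 3 (drop i l)) v" if "l \<in> words 3 m" "length v = 3" for l v
  proof -
    \<comment> \<open>Only the middle block of \<open>l\<close> meets the block \<open>v\<close> of
      \<open>g v\<close>.\<close>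
    have "l = take i l @ take 3 (drop i l) @ drop 3 (drop i l)" by (simp only: append_take_drop_id)
    hence "dot l (g v) = dot (take i l @ take 3 (drop i l) @ drop 3 (drop i l)) (g v)"
      by (rule arg_cong[where f = "\<lambda>x. dot x (g v)"])
    also have "\<dots> = dot (take 3 (drop i l)) v"
      unfolding g_def using that m by (simp add: dot_append words_length del: append_take_drop_id drop_drop)
    finally show ?thesis .
  qed
  \<comment> \<open>The two lines come from \<open>(1,0,0) + (0,1,0) = (1,1,0)\<close> and
    \<open>(1,0,0) + (0,0,1) = (1,0,1)\<close>.\<close>
  have rel: "3 dvd dot l (g u) + dot l (g v) + 2 * dot l (g w)"
    if l: "l \<in> words 3 m" and "(u, v, w) \<in> {([1,0,0], [0,1,0], [1,1,0]), ([1,0,0], [0,0,1], [1,0,1])}" for l u v w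
  proof -
    have "\<exists>a b c. x = [a, b, c]" if "length x = 3" for x :: "nat list"
      using that by (auto simp: numeral_3_eq_3 length_Suc_conv)
    moreover have "length (take 3 (drop i l)) = 3" using l m by (simp add: words_length)
    ultimately obtain a b c where "take 3 (drop i l) = [a, b, c]" by blast
    thus ?thesis using that dot_g[OF l] by auto
  qed
  have "\<exists>Q. quantum_code 3 (card X) (card X - 2 * m) 3 Q \<and> pure_code 3 (card X) 3 Q"
  proof (rule code_of_point_set)
    show "(g [1,0,0], replicate m 0) \<in> X" "(g [0,1,0], replicate m 0) \<in> X" "(g [1,1,0], replicate m 0) \<in> X"
      "(g [0,0,1], replicate m 0) \<in> X" "(g [1,0,1], replicate m 0) \<in> X"
      by (auto intro!: g simp: numeral_3_eq_3)
    show "distinct [g [1,0,0], g [0,1,0], g [1,1,0], g [0,0,1], g [1,0,1]]"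
      by (simp add: g_def)
  qed (use N in \<open>auto intro!: rel\<close>)
  thus ?thesis using hamming_bound_violated[OF size] N by auto
qed

lemma ternary_code_proj:
  assumes m: "3 \<le> m" and N: "2 * N + 1 = 3 ^ m"
  shows "\<exists>Q. quantum_code 3 N (N - 2 * m) 3 Q \<and> pure_code 3 N 3 Q \<and> QHB_at_least_almost_optimal 3 N (N - 2 * m) 3"
proof -
  define k where "k = m - 3"
  have mk: "m = 0 + (3 + k)" using m by (simp add: k_def)
  have c: "card (real_points m (proj_points m)) = N"
    using card_proj_points[of m] N by (simp add: card_real_points)
  have "27 \<le> (3::nat) ^ m" using power_increasing[OF m, of "3::nat"] by simp
  hence "3 ^ m + 4 \<le> 4 * N" using N by linarith
  moreover have "orthogonal_point_set m (real_points m (proj_points m))"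
    using m by (intro orthogonal_real_points proj_points_moment) auto
  moreover have "(replicate 0 0 @ v @ replicate k 0, replicate m 0) \<in> real_points m (proj_points m)"
    if "v \<in> proj_points 3" for v
    using append_zeros_in_proj_points[OF that, of k] mk by (simp add: real_points_def)
  ultimately show ?thesis
    using ternary_code_of_point_set[OF _ mk, of "real_points m (proj_points m)"] unfolding c by blast
qed

lemma power_3_split: "t + 2 \<le> m \<Longrightarrow> 9 * 3 ^ t \<le> (3::nat) ^ m"
  using power_increasing[of "t + 2" m "3::nat"] by simp

text \<open>The family for sign +1. The bound \<open>t + 2 \<le> m\<close> leaves room for the
  leading 1 and for the zero at the translated coordinate.\<close>

lemma ternary_code_add_affine:
  assumes t: "2 \<le> t" "t + 2 \<le> m" and N: "2 * N + 1 = 3 ^ m + 2 * 3 ^ t"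
  shows "\<exists>Q. quantum_code 3 N (N - 2 * m) 3 Q \<and> pure_code 3 N 3 Q \<and> QHB_at_least_almost_optimal 3 N (N - 2 * m) 3"
proof -
  define s k where "s = m - (t + 2)" and "k = m - 3"
  have ms: "Suc (Suc s + t) = m" and mk: "m = 0 + (3 + k)" using t by (auto simp: s_def k_def)
  have c: "card (mixed_points s t) = N"
    using card_proj_points[of m] N unfolding card_mixed_points ms by simp
  have "(9::nat) \<le> 3 ^ t" using power_increasing[OF t(1), of "3::nat"] by simp
  hence "3 ^ m + 4 \<le> 4 * N" using N power_3_split[OF t(2)] by linarith
  moreover have "orthogonal_point_set m (mixed_points s t)"
    using orthogonal_mixed_points[OF t(1), of s] unfolding ms .
  moreover have "(replicate 0 0 @ v @ replicate k 0, replicate m 0) \<in> mixed_points s t"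
    if "v \<in> proj_points 3" for v
    using append_zeros_in_proj_points[OF that, of k] mk
    unfolding mixed_points_def ms by (simp add: real_points_def)
  ultimately show ?thesis
    using ternary_code_of_point_set[OF _ mk, of "mixed_points s t"] unfolding c by blast
qed

lemma ternary_code_remove_affine:
  assumes t: "2 \<le> t" "t + 2 \<le> m" and N: "2 * N + 1 + 2 * 3 ^ t = 3 ^ m"
  shows "\<exists>Q. quantum_code 3 N (N - 2 * m) 3 Q \<and> pure_code 3 N 3 Q \<and> QHB_at_least_almost_optimal 3 N (N - 2 * m) 3"
proof -
  define s k where "s = m - (t + 1)" and "k = m - 4"
  have ms: "Suc (s + t) = m" and mk: "m = 1 + (3 + k)" using t by (auto simp: s_def k_def)
  define U where "U = proj_points m - affine_points s t"
  have "affine_points s t \<subseteq> proj_points m" using affine_points_subset[of s t] unfolding ms .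
  hence "card U = card (proj_points m) - 3 ^ t"
    unfolding U_def by (subst card_Diff_subset) (auto intro: finite_subset simp: card_affine_points)
  hence c: "card (real_points m U) = N"
    using card_proj_points[of m] N by (simp add: card_real_points)
  have "(9::nat) \<le> 3 ^ t" using power_increasing[OF t(1), of "3::nat"] by simp
  hence "3 ^ m + 4 \<le> 4 * N" using N power_3_split[OF t(2)] by linarith
  moreover have "orthogonal_point_set m (real_points m U)"
    using orthogonal_proj_minus_affine[OF t(1), of s] unfolding ms U_def .
  \<comment> \<open>The plane is placed at offset 1, inside the hyperplane with first coordinate 0,
    so it avoids the removed points, which all start with 1.\<close>
  moreover have "(replicate 1 0 @ v @ replicate k 0, replicate m 0) \<in> real_points m U"
    if "v \<in> proj_points 3" for v
    using zeros_append_in_proj_points[OF append_zeros_in_proj_points[OF that, of k], of 1] mk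
    by (auto simp: real_points_def U_def affine_points_def)
  ultimately show ?thesis
    using ternary_code_of_point_set[OF _ mk, of "real_points m U"] unfolding c by blast
qed

theorem theorem8:
  fixes n s :: nat and \<epsilon>0 :: int
  assumes "\<epsilon>0 \<in> {1, -1}"
  shows "(even (n + s) \<and> s + 4 \<le> n \<and> n + s \<ge> 6 \<longrightarrow>
      (let N = nat ((3 ^ (n - 1) + 2 * \<epsilon>0 * 3 ^ ((n + s) div 2 - 1) - 1) div 2);
           K = nat (int N - 2 * int n + 2)
       in \<exists>Q. quantum_code 3 N K 3 Q \<and> pure_code 3 N 3 Q \<and>
              QHB_at_least_almost_optimal 3 N K 3))
    \<and> (odd (n + s) \<and> s + 3 \<le> n \<and> n + s \<ge> 5 \<longrightarrow>
      (let N = (3 ^ (n - 1) - 1) div 2;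
           K = nat (int N - 2 * int n + 2)
       in \<exists>Q. quantum_code 3 N K 3 Q \<and> pure_code 3 N 3 Q \<and>
              QHB_at_least_almost_optimal 3 N K 3))"
proof -
  \<comment> \<open>Since \<open>2 * n - 2 = 2 * (n - 1)\<close>, truncated subtraction agrees with
    \<open>nat\<close> of the integer expression; both are 0 where that is negative.\<close>
  have K: "nat (int N - 2 * int n + 2) = N - 2 * (n - 1)" if "s + 3 \<le> n" for N
    using that by linarith
  define p where "p = card (proj_points (n - 1))"
  have p: "2 * p + 1 = 3 ^ (n - 1)" unfolding p_def by (rule card_proj_points)
  have pi: "(3::int) ^ (n - 1) = 2 * int p + 1" using arg_cong[OF p, of int] by simp
  \<comment> \<open>The dimension of the affine subspace to be added or removed.\<close>
  define t where "t = (n + s) div 2 - 1"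
  have even: "\<exists>Q. quantum_code 3 N (N - 2 * (n - 1)) 3 Q \<and> pure_code 3 N 3 Q \<and>
      QHB_at_least_almost_optimal 3 N (N - 2 * (n - 1)) 3"
    if par: "s + 4 \<le> n" "6 \<le> n + s" and N: "N = nat ((3 ^ (n - 1) + 2 * \<epsilon>0 * 3 ^ t - 1) div 2)" for N
  proof -
    \<comment> \<open>The bound \<open>s + 4 \<le> n\<close> gives
      \<open>(n + s) div 2 \<le> n - 2\<close>, and \<open>6 \<le> n + s\<close> gives
      \<open>2 \<le> t\<close>.\<close>
    have t: "2 \<le> t" "t + 2 \<le> n - 1" using par unfolding t_def by linarith+
    have "9 * 3 ^ t \<le> 2 * p + 1" using power_3_split[OF t(2)] p by simp
    \<comment> \<open>For sign -1 this keeps \<open>p - 3 ^ t\<close> from truncating.\<close>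
    hence le: "3 ^ t \<le> p" by linarith
    have "N = nat (int p + \<epsilon>0 * 3 ^ t)"
      unfolding N pi by (intro arg_cong[where f = nat]) (simp add: algebra_simps)
    moreover have "\<epsilon>0 = 1 \<or> \<epsilon>0 = -1" using assms by simp
    ultimately consider "N = p + 3 ^ t" | "N = p - 3 ^ t"
      by (auto simp: nat_add_distrib nat_diff_distrib' nat_power_eq)
    thus ?thesis
    proof cases
      case 1
      thus ?thesis using p by (intro ternary_code_add_affine[OF t]) simp
    next
      case 2
      thus ?thesis using le p by (intro ternary_code_remove_affine[OF t]) simp
    qed
  qed
  have odd: "\<exists>Q. quantum_code 3 N (N - 2 * (n - 1)) 3 Q \<and> pure_code 3 N 3 Q \<and>
      QHB_at_least_almost_optimal 3 N (N - 2 * (n - 1)) 3"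
    if par: "s + 3 \<le> n" "5 \<le> n + s" and N: "N = (3 ^ (n - 1) - 1) div 2" for N
  proof (rule ternary_code_proj)
    have "N = p" unfolding N p[symmetric] by simp
    thus "2 * N + 1 = 3 ^ (n - 1)" using p by simp
    \<comment> \<open>Adding the two bounds on \<open>n\<close> and \<open>s\<close> gives
      \<open>8 \<le> 2 * n\<close>.\<close>
    show "3 \<le> n - 1" using par by linarith
  qed
  show ?thesis
    unfolding Let_def t_def[symmetric]
  proof (intro conjI impI; elim conjE)
    assume par: "s + 4 \<le> n" "6 \<le> n + s"
    hence "s + 3 \<le> n" by linarith
    let ?N = "nat ((3 ^ (n - 1) + 2 * \<epsilon>0 * 3 ^ t - 1) div 2)"
    let ?K = "nat (int ?N - 2 * int n + 2)"
    show "\<exists>Q. quantum_code 3 ?N ?K 3 Q \<and> pure_code 3 ?N 3 Q \<and> QHB_at_least_almost_optimal 3 ?N ?K 3"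
      unfolding K[OF \<open>s + 3 \<le> n\<close>] by (rule even[OF par refl])
  next
    assume par: "s + 3 \<le> n" "5 \<le> n + s"
    let ?N = "(3 ^ (n - 1) - 1) div 2"
    let ?K = "nat (int ?N - 2 * int n + 2)"
    show "\<exists>Q. quantum_code 3 ?N ?K 3 Q \<and> pure_code 3 ?N 3 Q \<and> QHB_at_least_almost_optimal 3 ?N ?K 3"
      unfolding K[OF par(1)] by (rule odd[OF par refl])
  qed
qed

end
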